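(* Let $-(m\ell)^{-1/2}\le\alpha\le(m\ell)^{-1/2}$. Then: (i) $\beta_{\min}(\alpha;\mathbb{A}_{\mathbb{M}})=\beta_1(\alpha)$. (ii) There exists a unique string $dM^{[\alpha]}$ of minimal decay for the frequency $\alpha$ over $\mathbb{A}_{\mathbb{M}}$. (iii) $dM^{[\alpha]}=m_1\,\delta(x-a_1)\,dx$ with $m_1$ and $a_1$ given by: $m_1=m$, $a_1=\ell$ when $\alpha=0$; $m_1=m$, $a_1=\ell-\dfrac{1}{2m^{-1}+2(m^{-2}-\alpha^2)^{1/2}}$ when $0<\alpha^2<\frac{1}{m\ell}-\frac{1}{4\ell^2}$; $m_1=\dfrac{1}{(4\ell)^{-1}+\alpha^2\ell}$, $a_1=0$ when $\alpha\ne0$ and $\alpha^2\ge\frac{1}{m\ell}-\frac{1}{4\ell^2}$.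
   Context: Fix $\ell>0$ and $m>0$. A string is a bounded nonnegative Borel measure $dM$ on $[0,\ell]$; $\delta(x-a)\,dx$ is the unit point mass at $a$. For $z\in\mathbb{C}$, $\varphi(\cdot)=\varphi(\cdot,z;dM)$ is the unique continuous solution on $[0,\ell]$ of $\varphi(x)=1-z^2\int_{[0,x]}(x-s)\varphi(s)\,dM(s)$, and $F(z;dM):=\varphi(\ell,z;dM)-iz\int_{[0,\ell]}\varphi(s,z;dM)\,dM(s)$. The set $\Sigma(dM)$ of quasi-eigenvalues of $dM$ is the set of zeroes of $F(\cdot;dM)$. $\mathbb{A}_{\mathbb{M}}$ is the set of nonnegative Borel measures on $[0,\ell]$ with total mass $\le m$, and $\Sigma[\mathbb{A}_{\mathbb{M}}]:=\bigcup_{dM\in\mathbb{A}_{\mathbb{M}}}\Sigma(dM)$. For $\alpha\in\mathbb{R}$, $\beta_{\min}(\alpha;\mathbb{A}_{\mathbb{M}}):=\inf\{\beta\in\mathbb{R}:\alpha-i\beta\in\Sigma[\mathbb{A}_{\mathbb{M}}]\}$; a string $dM\in\mathbb{A}_{\mathbb{M}}$ is of minimal decay for the frequency $\alpha$ over $\mathbb{A}_{\mathbb{M}}$ if $\alpha-i\beta_{\min}(\alpha;\mathbb{A}_{\mathbb{M}})\in\Sigma(dM)$. The even function $\beta_1:\mathbb{R}\to(0,+\infty)$ is defined by $\beta_1(0):=m^{-1}$; $\beta_1(\alpha):=\frac{1}{2\ell}$ when $\alpha\ne0$ and $\alpha^2\ge\frac{1}{m\ell}-\frac{1}{4\ell^2}$;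 and (in the case $m<4\ell$) $\beta_1(\alpha):=m^{-1}+\sqrt{m^{-2}-\alpha^2}$ when $0<\alpha^2<\frac{1}{m\ell}-\frac{1}{4\ell^2}$. *)

theory Defs
  imports "HOL-Probability.Giry_Monad"
begin

text \<open>A string of length \<open>l\<close> is a bounded measure whose \<open>\<sigma>\<close>-algebra consists exactly of the Borel
  subsets of \<open>[0, l]\<close>, so that equality of strings is equality of type \<^typ>\<open>real measure\<close>.\<close>

definition is_string :: "real \<Rightarrow> real measure \<Rightarrow> bool" where
  "is_string l M \<longleftrightarrow> sets M = sets (restrict_space borel {0..l}) \<and> finite_measure M"

definition point_string :: "real \<Rightarrow> real \<Rightarrow> real \<Rightarrow> real measure" where
  "point_string l m1 a1 = scale_measure (ennreal m1) (return (restrict_space borel {0..l}) a1)"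

definition is_string_solution ::
    "real \<Rightarrow> real measure \<Rightarrow> complex \<Rightarrow> (real \<Rightarrow> complex) \<Rightarrow> bool" where
  "is_string_solution l M z \<phi> \<longleftrightarrow>
     continuous_on {0..l} \<phi> \<and>
     (\<forall>x\<in>{0..l}. \<phi> x = 1 - z\<^sup>2 * (LINT s:{0..x}|M. complex_of_real (x - s) * \<phi> s))"

text \<open>Solutions live on \<open>[0, l]\<close> only; membership in \<^term>\<open>extensional {0..l}\<close> fixes the
  irrelevant values outside, which makes the solution unique as a total function.\<close>

definition string_phi :: "real \<Rightarrow> real measure \<Rightarrow> complex \<Rightarrow> real \<Rightarrow> complex" where
  "string_phi l M z = (THE \<phi>. \<phi> \<in> extensional {0..l} \<and> is_string_solution l M z \<phi>)"

definition string_F :: "real \<Rightarrow> real measure \<Rightarrow> complex \<Rightarrow> complex" where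
  "string_F l M z =
     string_phi l M z l - \<i> * z * (LINT s:{0..l}|M. string_phi l M z s)"

definition quasi_eigenvalues :: "real \<Rightarrow> real measure \<Rightarrow> complex set" where
  "quasi_eigenvalues l M = {z. string_F l M z = 0}"

definition admissible_strings :: "real \<Rightarrow> real \<Rightarrow> real measure set" where
  "admissible_strings l m = {M. is_string l M \<and> emeasure M {0..l} \<le> ennreal m}"

definition admissible_quasi_eigenvalues :: "real \<Rightarrow> real \<Rightarrow> complex set" where
  "admissible_quasi_eigenvalues l m = (\<Union>M\<in>admissible_strings l m. quasi_eigenvalues l M)"

text \<open>The infimum is taken in the extended reals, so it is \<open>\<infinity>\<close> when no \<open>\<beta>\<close> qualifies.\<close>

definition beta_min :: "real \<Rightarrow> real \<Rightarrow> real \<Rightarrow> ereal" where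
  "beta_min l m \<alpha> =
     (INF \<beta>\<in>{\<beta>::real. complex_of_real \<alpha> - \<i> * complex_of_real \<beta>
        \<in> admissible_quasi_eigenvalues l m}. ereal \<beta>)"

definition minimal_decay :: "real \<Rightarrow> real \<Rightarrow> real \<Rightarrow> real measure \<Rightarrow> bool" where
  "minimal_decay l m \<alpha> M \<longleftrightarrow>
     M \<in> admissible_strings l m \<and>
     (\<exists>\<beta>::real. ereal \<beta> = beta_min l m \<alpha> \<and>
        complex_of_real \<alpha> - \<i> * complex_of_real \<beta> \<in> quasi_eigenvalues l M)"

definition minimal_decay_string :: "real \<Rightarrow> real \<Rightarrow> real \<Rightarrow> real measure" where
  "minimal_decay_string l m \<alpha> = (THE M. minimal_decay l m \<alpha> M)"

definition beta1 :: "real \<Rightarrow> real \<Rightarrow> real \<Rightarrow> real" where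
  "beta1 l m \<alpha> =
     (if \<alpha> = 0 then 1 / m
      else if \<alpha>\<^sup>2 \<ge> 1 / (m * l) - 1 / (4 * l\<^sup>2) then 1 / (2 * l)
      else 1 / m + sqrt (1 / m\<^sup>2 - \<alpha>\<^sup>2))"

end

theory Submission
  imports Defs
begin

text \<open>
  Put \<open>k = \<i> z = \<beta> + \<i> \<alpha>\<close>, \<open>N(x) = \<integral>\<^bsub>[0,x]\<^esub> \<phi> dM\<close>, \<open>A(x) = \<integral>\<^bsub>[0,x]\<^esub> |\<phi>|\<^sup>2 dM\<close> and
  \<open>Q(x) = \<integral>\<^bsub>[0,x]\<^esub> |N|\<^sup>2 dt\<close>. Testing the equation with \<open>cnj \<phi>\<close> on \<open>[0, x]\<close> gives
  \<open>\<phi>(x) cnj N(x) = A(x) + k\<^sup>2 Q(x)\<close>; at \<open>x = l\<close> the boundary condition \<open>\<phi>(l) = k N(l)\<close> turns this into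
  \<open>k |N(l)|\<^sup>2 = A(l) + k\<^sup>2 Q(l)\<close>, so for \<open>\<alpha> \<noteq> 0\<close> we get \<open>|N(l)|\<^sup>2 = 2 \<beta> Q(l)\<close> and \<open>A(l) = |k|\<^sup>2 Q(l)\<close>.

  Two inequalities then suffice. Cauchy-Schwarz, \<open>|N(l)|\<^sup>2 \<le> m A(l)\<close>, yields \<open>2 \<beta> \<le> m |k|\<^sup>2\<close> (and
  \<open>\<beta> \<ge> 1/m\<close> for \<open>\<alpha> = 0\<close>), with equality only if \<open>\<phi>\<close> is constant \<open>M\<close>-almost everywhere, which forces a
  single point mass \<open>m\<close>. Secondly \<open>d|N|\<^sup>2 = 2 Re (\<phi> cnj N) dM\<close> up to atoms, and \<open>Re (\<phi> cnj N) =
  A + (\<beta>\<^sup>2 - \<alpha>\<^sup>2) Q \<ge> 0\<close> because \<open>Q(x) \<le> x m A(x)\<close> and \<open>\<alpha>\<^sup>2 m l \<le> 1\<close>. Hence \<open>|N|\<close> increases,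
  \<open>Q(l) \<le> l |N(l)|\<^sup>2\<close>, and \<open>\<beta> \<ge> 1/(2l)\<close>, with equality only if \<open>M\<close> is concentrated at \<open>0\<close>.
\<close>

section \<open>Measurability and Fubini for bounded kernels\<close>

lemma measurable_cnj [measurable (raw)]:
  "f \<in> borel_measurable M \<Longrightarrow> (\<lambda>x. cnj (f x)) \<in> borel_measurable M"
  by (intro borel_measurable_continuous_on[where f = cnj] continuous_intros)

text \<open>A bounded measurable kernel is integrable over a product of finite measures, which is
  all that Fubini asks. It serves both for \<open>M\<close> with itself and for \<open>M\<close>
  with Lebesgue measure on \<open>[0, l]\<close>.\<close>

lemma Fubini_bounded:
  fixes f :: "'a \<Rightarrow> 'b \<Rightarrow> 'c::{banach, second_countable_topology}"
  assumes "finite_measure M" "finite_measure L"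
    and "case_prod f \<in> borel_measurable (M \<Otimes>\<^sub>M L)"
    and "\<And>x y. x \<in> space M \<Longrightarrow> y \<in> space L \<Longrightarrow> norm (f x y) \<le> B"
  shows "(LINT x|M. LINT y|L. f x y) = (LINT y|L. LINT x|M. f x y)"
proof -
  interpret M: finite_measure M by fact
  interpret L: finite_measure L by fact
  interpret pair_sigma_finite M L ..
  interpret P: finite_measure "M \<Otimes>\<^sub>M L"
    using assms(2,1) by (rule finite_measure_pair_measure)
  have "integrable (M \<Otimes>\<^sub>M L) (case_prod f)"
    using assms(3,4) by (intro P.integrable_const_bound[where B = B]) (auto simp: space_pair_measure)
  then show ?thesis by (rule Fubini_integral[symmetric])
qed

section \<open>Strings as finite measures on \<open>[0, l]\<close>, and the kernel of the string
  equation\<close>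

locale krein_string =
  fixes l :: real and M :: "real measure"
  assumes l_pos: "l > 0" and string: "is_string l M"
begin

lemma sets_M: "sets M = sets (restrict_space borel {0..l})"
  using string by (simp add: is_string_def)

lemma space_M: "space M = {0..l}"
  using sets_eq_imp_space_eq[OF sets_M] by (simp add: space_restrict_space)

sublocale finite_measure M
  using string by (simp add: is_string_def)

lemma in_sets_M: "A \<in> sets borel \<Longrightarrow> A \<subseteq> {0..l} \<Longrightarrow> A \<in> sets M"
  by (auto simp: sets_M sets_restrict_space)

lemma measurable_borel_M [measurable (raw)]:
  "f \<in> borel_measurable borel \<Longrightarrow> f \<in> borel_measurable M"
  using measurable_restrict_space1[of f borel borel "{0..l}"] measurable_cong_sets[OF sets_M refl]
  by blast

lemma measurable_ident_M [measurable]: "(\<lambda>x. x) \<in> borel_measurable M"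
  by (rule measurable_borel_M) simp

lemma continuous_on_measurable_M:
  "continuous_on {0..l} f \<Longrightarrow> f \<in> borel_measurable M"
  using borel_measurable_continuous_on_restrict[of "{0..l}" f] measurable_cong_sets[OF sets_M refl]
  by blast

lemma continuous_on_bounded:
  fixes f :: "real \<Rightarrow> complex"
  assumes "continuous_on {0..l} f"
  obtains B where "B \<ge> 0" "\<And>x. x \<in> {0..l} \<Longrightarrow> norm (f x) \<le> B"
proof -
  have "bounded (f ` {0..l})"
    using assms by (intro compact_imp_bounded compact_continuous_image) auto
  then obtain B where B: "\<And>x. x \<in> {0..l} \<Longrightarrow> norm (f x) \<le> B"
    unfolding bounded_iff by blast
  have "B \<ge> 0" using B[of 0] l_pos norm_ge_zero[of "f 0"] by (simp del: norm_ge_zero)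
  with B show thesis using that by blast
qed

lemma integrable_bounded:
  fixes f :: "real \<Rightarrow> 'b::{banach, second_countable_topology}"
  assumes "f \<in> borel_measurable M" "\<And>x. x \<in> {0..l} \<Longrightarrow> norm (f x) \<le> B"
  shows "integrable M f"
  using assms by (intro integrable_const_bound[where B = B]) (auto simp: space_M)

lemma norm_integral_le:
  fixes f :: "real \<Rightarrow> 'b::{banach, second_countable_topology}"
  assumes "f \<in> borel_measurable M" "\<And>x. x \<in> {0..l} \<Longrightarrow> norm (f x) \<le> B"
  shows "norm (integral\<^sup>L M f) \<le> B * measure M (space M)"
proof -
  have "norm (integral\<^sup>L M f) \<le> (LINT x|M. norm (f x))"
    by (rule integral_norm_bound)
  also have "\<dots> \<le> (LINT x|M. B)"
    using assms by (intro integral_mono integrable_norm integrable_bounded) (auto simp: space_M)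
  finally show ?thesis by (simp add: mult_ac)
qed

lemma integrable_kernel:
  fixes f :: "real \<Rightarrow> complex"
  assumes "continuous_on {0..l} f"
  shows "integrable M (\<lambda>s. complex_of_real (max 0 (x - s)) * f s)"
proof -
  obtain B where B: "B \<ge> 0" "\<And>x. x \<in> {0..l} \<Longrightarrow> norm (f x) \<le> B"
    using continuous_on_bounded[OF assms] by blast
  have [measurable]: "f \<in> borel_measurable M"
    using assms by (rule continuous_on_measurable_M)
  show ?thesis
    by (rule integrable_bounded[where B = "\<bar>x\<bar> * B"])
      (auto simp: norm_mult intro!: mult_mono B)
qed

text \<open>The kernel \<open>max 0 (x - s)\<close> is 1-Lipschitz in \<open>x\<close>, so the
  integral is Lipschitz with constant \<open>B\<close> times the mass, atoms or not.\<close>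

lemma continuous_on_kernel_integral:
  fixes f :: "real \<Rightarrow> complex"
  assumes f: "continuous_on {0..l} f"
  shows "continuous_on S (\<lambda>x. LINT s|M. complex_of_real (max 0 (x - s)) * f s)"
proof -
  obtain B where B: "B \<ge> 0" "\<And>x. x \<in> {0..l} \<Longrightarrow> norm (f x) \<le> B"
    using continuous_on_bounded[OF f] by blast
  have [measurable]: "f \<in> borel_measurable M"
    using f by (rule continuous_on_measurable_M)
  let ?\<mu> = "measure M (space M)"
  have "(B * ?\<mu>)-lipschitz_on S (\<lambda>x. LINT s|M. complex_of_real (max 0 (x - s)) * f s)"
  proof (rule lipschitz_onI)
    fix x y
    have "dist (LINT s|M. complex_of_real (max 0 (x - s)) * f s)
        (LINT s|M. complex_of_real (max 0 (y - s)) * f s)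
      = norm (LINT s|M. complex_of_real (max 0 (x - s) - max 0 (y - s)) * f s)"
      unfolding dist_norm
      by (subst Bochner_Integration.integral_diff[OF integrable_kernel integrable_kernel, OF f f, symmetric])
        (simp add: left_diff_distrib)
    also have "\<dots> \<le> dist x y * B * ?\<mu>"
      by (rule norm_integral_le)
        (auto intro!: mult_mono B simp: norm_mult dist_real_def simp del: of_real_diff)
    finally show "dist (LINT s|M. complex_of_real (max 0 (x - s)) * f s)
        (LINT s|M. complex_of_real (max 0 (y - s)) * f s) \<le> B * ?\<mu> * dist x y"
      by (simp add: mult_ac)
  qed (use B in auto)
  then show ?thesis by (rule lipschitz_on_continuous_on)
qed

text \<open>The factor \<open>x - s\<close> vanishes at the moving end point, so cutting the
  integral off at \<open>x\<close> can be absorbed into a continuous kernel over the fixed domain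
  \<open>[0, l]\<close>.\<close>

lemma string_solution_iff:
  "is_string_solution l M z \<phi> \<longleftrightarrow> continuous_on {0..l} \<phi> \<and>
     (\<forall>x\<in>{0..l}. \<phi> x = 1 - z\<^sup>2 * (LINT s|M. complex_of_real (max 0 (x - s)) * \<phi> s))"
proof -
  have "(LINT s:{0..x}|M. complex_of_real (x - s) * \<phi> s) =
      (LINT s|M. complex_of_real (max 0 (x - s)) * \<phi> s)" for x
    unfolding set_lebesgue_integral_def
    by (rule Bochner_Integration.integral_cong) (auto simp: space_M indicator_def max_def)
  then show ?thesis unfolding is_string_solution_def by simp
qed


subsection \<open>Existence and uniqueness of solutions\<close>

text \<open>Follows from \<open>u < exp u\<close>. In the weighted norm each application of the
  integral operator gains a factor \<open>1 / \<theta>\<close>.\<close>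

lemma exp_weighted_kernel_le:
  fixes u \<theta> :: real
  assumes "\<theta> > 0"
  shows "max 0 u * exp (- \<theta> * u) \<le> 1 / \<theta>"
proof (cases "u \<ge> 0")
  case True
  have "\<theta> * u \<le> exp (\<theta> * u)" using exp_ge_add_one_self[of "\<theta> * u"] by linarith
  then show ?thesis using assms True by (simp add: exp_minus field_simps)
qed (use assms in auto)

text \<open>Conjugation by the weight \<open>exp (\<theta> x)\<close> turns the integral operator into a contraction.\<close>

lemma string_solution_ex1:
  "\<exists>!\<phi>. \<phi> \<in> extensional {0..l} \<and> is_string_solution l M z \<phi>"
proof -
  \<comment> \<open>Chosen so that \<open>(norm z)\<^sup>2\<close> times the mass, divided by
    \<open>\<theta>\<close>, is at most \<open>1/2\<close>. The summand 1 keeps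
    \<open>\<theta>\<close> positive when \<open>z\<close> or the mass is zero.\<close>
  define \<theta> where "\<theta> = 2 * (norm z)\<^sup>2 * measure M (space M) + 1"
  have \<theta>: "\<theta> > 0" by (simp add: \<theta>_def add_nonneg_pos)
  define E :: "real \<Rightarrow> complex" where "E x = complex_of_real (exp (\<theta> * x))" for x
  have E_nz: "E x \<noteq> 0" for x by (simp add: E_def)
  have E_cont: "continuous_on S E" for S unfolding E_def by (intro continuous_intros)
  define K where "K f x = (LINT s|M. complex_of_real (max 0 (x - s)) * f s)" for f and x :: real
  define G where "G \<psi> x = (1 - z\<^sup>2 * K (\<lambda>s. E s * \<psi> s) x) / E x" for \<psi> x
  \<comment> \<open>\<open>T\<close> acts on the complete space of bounded continuous functions on
    the whole line: \<open>clamp\<close> extends values on \<open>[0, l]\<close> by constants, and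
    \<open>SOME\<close> picks the function whose existence
    \<open>continuous_on_cbox_bcontfunE\<close> provides.\<close>
  define T where "T \<psi> = (SOME g. \<forall>x. apply_bcontfun g x =
      G (apply_bcontfun \<psi>) (clamp 0 l x))" for \<psi> :: "real \<Rightarrow>\<^sub>C complex"
  have G_cont: "continuous_on {0..l} (G \<psi>)" if "continuous_on {0..l} \<psi>" for \<psi>
    unfolding G_def K_def using E_nz
    by (intro continuous_intros continuous_on_kernel_integral E_cont that) auto
  have T: "apply_bcontfun (T \<psi>) x = G (apply_bcontfun \<psi>) (clamp 0 l x)" for \<psi> x
  proof -
    have "continuous_on (cbox 0 l) (G (apply_bcontfun \<psi>))" using G_cont by simp
    then have "\<exists>g. \<forall>x. apply_bcontfun g x = G (apply_bcontfun \<psi>) (clamp 0 l x)"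
      by (rule continuous_on_cbox_bcontfunE) blast
    from someI_ex[OF this] show ?thesis unfolding T_def by blast
  qed
  have clamp_in: "clamp 0 l x \<in> {0..l}" for x using clamp_in_interval[of 0 l x] l_pos by simp
  have clamp_id: "clamp 0 l x = x" if "x \<in> {0..l}" for x using clamp_cancel_cbox[of x 0 l] that by simp
  have K_diff: "norm (K (\<lambda>s. E s * f s) x - K (\<lambda>s. E s * g s) x) \<le>
      exp (\<theta> * x) * (d / \<theta> * measure M (space M))"
    if f: "continuous_on {0..l} f" and g: "continuous_on {0..l} g"
      and d: "\<And>s. s \<in> {0..l} \<Longrightarrow> norm (f s - g s) \<le> d" for f g d x
  proof -
    have d0: "d \<ge> 0" using d[of 0] l_pos norm_ge_zero[of "f 0 - g 0"] by (simp del: norm_ge_zero)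
    have [measurable]: "f \<in> borel_measurable M" "g \<in> borel_measurable M" "E \<in> borel_measurable M"
      using f g E_cont by (auto intro: continuous_on_measurable_M)
    have *: "norm (complex_of_real (max 0 (x - s)) * (E s * (f s - g s))) \<le> exp (\<theta> * x) * (d / \<theta>)"
      if "s \<in> {0..l}" for s
    proof -
      have "exp (\<theta> * s) = exp (\<theta> * x) * exp (- \<theta> * (x - s))"
          by (simp add: exp_add[symmetric] algebra_simps)
      then have "norm (complex_of_real (max 0 (x - s)) * (E s * (f s - g s)))
         = exp (\<theta> * x) * ((max 0 (x - s) * exp (- \<theta> * (x - s))) * norm (f s - g s))"
        by (simp add: norm_mult E_def)
      also have "\<dots> \<le> exp (\<theta> * x) * (1 / \<theta> * d)"
        using exp_weighted_kernel_le[OF \<theta>, of "x - s"] d[OF that] \<theta>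
        by (intro mult_left_mono mult_mono) auto
      finally show ?thesis by simp
    qed
    have "K (\<lambda>s. E s * f s) x - K (\<lambda>s. E s * g s) x
        = (LINT s|M. complex_of_real (max 0 (x - s)) * (E s * (f s - g s)))"
      unfolding K_def
      by (subst Bochner_Integration.integral_diff[OF integrable_kernel integrable_kernel, symmetric])
        (auto intro!: continuous_intros E_cont f g simp: algebra_simps)
    also have "norm \<dots> \<le> exp (\<theta> * x) * (d / \<theta>) * measure M (space M)"
      using * by (intro norm_integral_le) auto
    finally show ?thesis by (simp add: mult_ac)
  qed
  have "dist (T \<psi>) (T \<xi>) \<le> 1/2 * dist \<psi> \<xi>" for \<psi> \<xi>
  proof (rule dist_bound)
    fix x
    let ?y = "clamp 0 l x" and ?d = "dist \<psi> \<xi>"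
    have "dist (apply_bcontfun (T \<psi>) x) (apply_bcontfun (T \<xi>) x)
       = norm (z\<^sup>2 * (K (\<lambda>s. E s * apply_bcontfun \<psi> s) ?y - K (\<lambda>s. E s * apply_bcontfun \<xi> s) ?y) / E ?y)"
      unfolding T G_def dist_norm
      by (subst norm_minus_commute) (simp add: diff_divide_distrib algebra_simps)
    also from \<theta> have "\<dots> \<le> (norm z)\<^sup>2 * (exp (\<theta> * ?y) * (?d / \<theta> * measure M (space M))) / exp (\<theta> * ?y)"
      unfolding norm_divide norm_mult norm_power
      by (intro frac_le mult_left_mono K_diff)
        (auto simp: E_def dist_norm[symmetric] intro: dist_bounded intro!: divide_nonneg_pos mult_nonneg_nonneg)
    also have "\<dots> = ((norm z)\<^sup>2 * measure M (space M) / \<theta>) * ?d" by simp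
    also have "\<dots> \<le> 1/2 * ?d"
      using \<theta> by (intro mult_right_mono) (auto simp: \<theta>_def divide_simps)
    finally show "dist (apply_bcontfun (T \<psi>) x) (apply_bcontfun (T \<xi>) x) \<le> 1/2 * ?d" .
  qed
  then have fixp: "\<exists>!\<psi>. T \<psi> = \<psi>" by (intro banach_fix_type[of "1/2"]) auto
  have K_cong: "K f x = K g x" if "\<And>s. s \<in> {0..l} \<Longrightarrow> f s = g s" for f g x
    unfolding K_def by (rule Bochner_Integration.integral_cong) (auto simp: space_M that)
  show ?thesis
  proof (rule ex_ex1I)
    from fixp obtain \<psi> where \<psi>: "T \<psi> = \<psi>" by blast
    define \<phi> where "\<phi> = restrict (\<lambda>x. E x * apply_bcontfun \<psi> x) {0..l}"
    have "continuous_on {0..l} \<phi>"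
      unfolding \<phi>_def restrict_def
      by (subst continuous_on_cong[OF refl, where g = "\<lambda>x. E x * apply_bcontfun \<psi> x"])
        (auto intro!: continuous_intros E_cont)
    moreover have "\<phi> x = 1 - z\<^sup>2 * K \<phi> x" if "x \<in> {0..l}" for x
    proof -
      have "apply_bcontfun \<psi> x = G (apply_bcontfun \<psi>) x" using T[of \<psi> x] \<psi> clamp_id[OF that] by simp
      then have "E x * apply_bcontfun \<psi> x = 1 - z\<^sup>2 * K (\<lambda>s. E s * apply_bcontfun \<psi> s) x"
        using E_nz[of x] by (simp add: G_def)
      also have "K (\<lambda>s. E s * apply_bcontfun \<psi> s) x = K \<phi> x" by (rule K_cong) (simp add: \<phi>_def)
      finally show ?thesis using that by (simp add: \<phi>_def)
    qed
    ultimately show "\<exists>\<phi>. \<phi> \<in> extensional {0..l} \<and> is_string_solution l M z \<phi>"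
      unfolding string_solution_iff K_def[symmetric]
          using restrict_extensional[of _ "{0..l}"] \<phi>_def by blast
  next
    fix \<phi> \<xi> assume A: "\<phi> \<in> extensional {0..l} \<and> is_string_solution l M z \<phi>"
      "\<xi> \<in> extensional {0..l} \<and> is_string_solution l M z \<xi>"
    \<comment> \<open>Any solution, divided by the weight and extended by \<open>clamp\<close>, is a
      fixed point of \<open>T\<close>. Uniqueness of the fixed point thus gives uniqueness on
      \<open>[0, l]\<close>, and extensionality settles the values elsewhere.\<close>
    have fp: "\<exists>\<psi>. T \<psi> = \<psi> \<and> (\<forall>x\<in>{0..l}. f x = E x * apply_bcontfun \<psi> x)"
        if "is_string_solution l M z f" for f
    proof -
      from that have f: "continuous_on {0..l} f" "\<And>x. x \<in> {0..l} \<Longrightarrow> f x = 1 - z\<^sup>2 * K f x"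
        by (auto simp: string_solution_iff K_def)
      have "continuous_on (cbox 0 l) (\<lambda>x. f x / E x)"
          using E_nz by (auto intro!: continuous_intros f E_cont)
      then obtain \<psi> :: "real \<Rightarrow>\<^sub>C complex"
          where \<psi>: "\<And>x. apply_bcontfun \<psi> x = f (clamp 0 l x) / E (clamp 0 l x)"
        by (rule continuous_on_cbox_bcontfunE) blast
      have "K (\<lambda>s. E s * apply_bcontfun \<psi> s) x = K f x" for x
        by (rule K_cong) (auto simp: \<psi> clamp_id E_nz)
      then have "T \<psi> = \<psi>" by (intro bcontfun_eqI) (simp add: T \<psi> G_def f(2)[OF clamp_in, symmetric])
      then show ?thesis by (intro exI[of _ \<psi>]) (simp add: \<psi> clamp_id E_nz)
    qed
    with fixp A have "\<phi> x = \<xi> x" if "x \<in> {0..l}" for x using that by metis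
    then show "\<phi> = \<xi>" using A extensionalityI by blast
  qed
qed

lemma string_phi_solution: "is_string_solution l M z (string_phi l M z)"
  using theI'[OF string_solution_ex1] unfolding string_phi_def by blast

text \<open>Restricting to \<open>{0..l}\<close> affects neither continuity there nor the integrals,
  so an explicit solution may be given by a formula on the whole line.\<close>

lemma string_phi_unique:
  assumes "is_string_solution l M z \<phi>" "x \<in> {0..l}"
  shows "string_phi l M z x = \<phi> x"
proof -
  let ?\<phi> = "restrict \<phi> {0..l}"
  have "(LINT s|M. complex_of_real (max 0 (y - s)) * ?\<phi> s) =
      (LINT s|M. complex_of_real (max 0 (y - s)) * \<phi> s)" for y
    by (rule Bochner_Integration.integral_cong) (auto simp: space_M)
  moreover have "continuous_on {0..l} ?\<phi> \<longleftrightarrow> continuous_on {0..l} \<phi>"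
    by (rule continuous_on_cong) auto
  ultimately have "is_string_solution l M z ?\<phi>"
    using assms(1) by (simp add: string_solution_iff)
  then have "string_phi l M z = ?\<phi>"
    unfolding string_phi_def by (intro the1_equality[OF string_solution_ex1]) auto
  then show ?thesis using assms(2) by simp
qed


section \<open>Variance and the Cauchy-Schwarz inequality\<close>

lemma integrable_bounded_product:
  fixes f g :: "real \<Rightarrow> complex"
  assumes "continuous_on {0..l} f" "g \<in> borel_measurable M" "\<And>x. x \<in> {0..l} \<Longrightarrow> norm (g x) \<le> C"
  shows "integrable M (\<lambda>x. g x * f x)"
proof -
  obtain B where B: "B \<ge> 0" "\<And>x. x \<in> {0..l} \<Longrightarrow> norm (f x) \<le> B"
    using continuous_on_bounded[OF assms(1)] by blast
  note [measurable] = continuous_on_measurable_M[OF assms(1)] assms(2)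
  have "0 \<le> C" using assms(3)[of 0] norm_ge_zero[of "g 0"] l_pos by (simp del: norm_ge_zero)
  then show ?thesis
    by (intro integrable_bounded[where B = "C * B"]) (auto simp: norm_mult intro!: mult_mono B assms)
qed

text \<open>Expand the square. Scaling \<open>f\<close> by \<open>\<mu>\<close> instead of dividing
  by it keeps the identity valid for zero mass. The bracket on the right is the Cauchy-Schwarz
  deficit, so equality there forces \<open>f\<close> to be constant almost everywhere when
  \<open>\<mu> > 0\<close>.\<close>

lemma variance_identity:
  fixes f :: "real \<Rightarrow> complex"
  assumes [measurable]: "f \<in> borel_measurable M" and B: "\<And>x. x \<in> {0..l} \<Longrightarrow> norm (f x) \<le> B"
  defines "\<mu> \<equiv> measure M (space M)"
  shows "(LINT s|M. (norm (\<mu> * f s - integral\<^sup>L M f))\<^sup>2)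
     = \<mu> * (\<mu> * (LINT s|M. (norm (f s))\<^sup>2) - (norm (integral\<^sup>L M f))\<^sup>2)"
proof -
  let ?c = "integral\<^sup>L M f"
  have 1: "(norm (\<mu> * f s - ?c))\<^sup>2 = \<mu>\<^sup>2 * (norm (f s))\<^sup>2
      - 2 * \<mu> * Re (cnj ?c * f s) + (norm ?c)\<^sup>2" for s
    unfolding cmod_power2 by (simp add: power2_eq_square algebra_simps)
  have i1: "integrable M (\<lambda>s. (norm (f s))\<^sup>2)"
    by (rule integrable_bounded[where B = "B\<^sup>2"]) (auto intro!: power_mono B)
  have i2: "integrable M f" by (rule integrable_bounded[where B = B]) (auto intro: B)
  have "(LINT s|M. Re (cnj ?c * f s)) = Re (cnj ?c * ?c)"
    using i2 by (simp add: integral_Re)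
  also have "cnj ?c * ?c = of_real ((norm ?c)\<^sup>2)"
    by (metis complex_norm_square mult.commute of_real_power)
  finally have "(LINT s|M. Re (cnj ?c * f s)) = (norm ?c)\<^sup>2" by simp
  moreover have "integrable M (\<lambda>s. Re (cnj ?c * f s))"
      using i2 by (intro integrable_Re integrable_mult_right)
  ultimately have "(LINT s|M. \<mu>\<^sup>2 * (norm (f s))\<^sup>2 - 2 * \<mu> * Re (cnj ?c * f s) + (norm ?c)\<^sup>2)
      = \<mu>\<^sup>2 * (LINT s|M. (norm (f s))\<^sup>2) - 2 * \<mu> * (norm ?c)\<^sup>2 + (norm ?c)\<^sup>2 * \<mu>"
    using i1 by (simp add: \<mu>_def del: times_complex.sel)
  then show ?thesis unfolding 1 by (simp add: power2_eq_square algebra_simps)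
qed

lemma Cauchy_Schwarz_integral:
  fixes f :: "real \<Rightarrow> complex"
  assumes [measurable]: "f \<in> borel_measurable M" and B: "\<And>x. x \<in> {0..l} \<Longrightarrow> norm (f x) \<le> B"
  shows "(norm (integral\<^sup>L M f))\<^sup>2 \<le> measure M (space M) * (LINT s|M. (norm (f s))\<^sup>2)"
proof (cases "measure M (space M) = 0")
  case True
  have "norm (integral\<^sup>L M f) \<le> 0" using norm_integral_le[OF assms(1) B] True by simp
  with True show ?thesis by simp
next
  case False
  then have pos: "measure M (space M) > 0" by (simp add: less_le)
  have "0 \<le> (LINT s|M. (norm (measure M (space M) * f s - integral\<^sup>L M f))\<^sup>2)"
    by (rule Bochner_Integration.integral_nonneg) simp
  then have "0 \<le> measure M (space M) * (measure M (space M) * (LINT s|M. (norm (f s))\<^sup>2)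
      - (norm (integral\<^sup>L M f))\<^sup>2)"
    by (simp only: variance_identity[OF assms])
  with pos show ?thesis by (simp add: zero_le_mult_iff)
qed

end

subsection \<open>Energy and virial identities\<close>

text \<open>The spectral parameter is \<open>k = \<i> z\<close>, so that \<open>-z\<^sup>2 = k\<^sup>2\<close>.\<close>

locale krein_solution = krein_string +
  fixes k :: complex and \<phi> :: "real \<Rightarrow> complex"
  assumes cont: "continuous_on {0..l} \<phi>"
    and sol: "\<And>x. x \<in> {0..l} \<Longrightarrow>
      \<phi> x = 1 + k\<^sup>2 * (LINT s|M. complex_of_real (max 0 (x - s)) * \<phi> s)"
begin

text \<open>Below, \<open>k\<^sup>2 * Nle x\<close> and \<open>k\<^sup>2 * Nlt x\<close> are the
  right and left derivatives of \<open>\<phi>\<close> at interior points \<open>x\<close>. They can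
  differ only at an atom of \<open>M\<close>. \<open>Q\<close> is the Dirichlet energy of
  \<open>\<phi>\<close> up to the factor \<open>(norm k)^4\<close>.\<close>

definition L :: "real measure" where "L = restrict_space lborel {0..l}"

definition Nle :: "real \<Rightarrow> complex" where "Nle x = (LINT s|M. of_bool (s \<le> x) * \<phi> s)"
definition Nlt :: "real \<Rightarrow> complex" where "Nlt x = (LINT s|M. of_bool (s < x) * \<phi> s)"
definition Ale :: "real \<Rightarrow> real" where "Ale x = (LINT s|M. of_bool (s \<le> x) * (norm (\<phi> s))\<^sup>2)"
definition Alt :: "real \<Rightarrow> real" where "Alt x = (LINT s|M. of_bool (s < x) * (norm (\<phi> s))\<^sup>2)"
definition Q :: "real \<Rightarrow> real" where "Q x = (LINT t|L. of_bool (t < x) * (norm (Nle t))\<^sup>2)"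

lemma space_L: "space L = {0..l}"
  by (simp add: L_def space_restrict_space)

lemma in_sets_L: "A \<in> sets borel \<Longrightarrow> A \<subseteq> {0..l} \<Longrightarrow> A \<in> sets L"
  by (auto simp: L_def sets_restrict_space)

lemma measure_L: "A \<in> sets borel \<Longrightarrow> A \<subseteq> {0..l} \<Longrightarrow> measure L A = measure lborel A"
  by (simp add: L_def measure_restrict_space)

lemma measurable_ident_L [measurable]: "(\<lambda>x. x) \<in> borel_measurable L"
  unfolding L_def by (rule measurable_restrict_space1) simp

lemma finite_L: "finite_measure L"
  by (rule finite_measureI) (use l_pos in \<open>simp add: L_def emeasure_restrict_space space_restrict_space emeasure_lborel_Icc_eq\<close>)

lemma measurable_phi [measurable]: "\<phi> \<in> borel_measurable M"
  using cont by (rule continuous_on_measurable_M)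

lemma measurable_Nle [measurable]: "Nle \<in> borel_measurable L"
proof -
  have "(\<lambda>x. LINT s|M. (if s \<le> x then \<phi> s else 0)) \<in> borel_measurable L"
    by measurable
  also have "(\<lambda>x. LINT s|M. (if s \<le> x then \<phi> s else 0)) = Nle"
    unfolding Nle_def by (intro ext Bochner_Integration.integral_cong) auto
  finally show ?thesis .
qed


lemma phi_bounded:
  obtains B where "B \<ge> 0" "\<And>x. x \<in> {0..l} \<Longrightarrow> norm (\<phi> x) \<le> B"
  using continuous_on_bounded[OF cont] by blast

lemma integrable_mult_phi:
  assumes "g \<in> borel_measurable M" "\<And>x. x \<in> {0..l} \<Longrightarrow> norm (g x) \<le> C"
  shows "integrable M (\<lambda>x. g x * \<phi> x)"
  using cont assms by (rule integrable_bounded_product)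

lemma measurable_of_bool_le [measurable]:
  "(\<lambda>s. of_bool (s \<le> x) :: 'b::{real_normed_algebra_1}) \<in> borel_measurable M"
  "(\<lambda>s. of_bool (s < x) :: 'b) \<in> borel_measurable M"
  "(\<lambda>s. of_bool (x < s) :: 'b) \<in> borel_measurable M"
  unfolding of_bool_def by measurable

lemma integrable_sqnorm:
  assumes [measurable]: "Measurable.pred M P"
  shows "integrable M (\<lambda>s. of_bool (P s) * (norm (\<phi> s))\<^sup>2)"
proof -
  obtain B where B: "B \<ge> 0" "\<And>x. x \<in> {0..l} \<Longrightarrow> norm (\<phi> x) \<le> B" using phi_bounded by blast
  have [measurable]: "(\<lambda>s. of_bool (P s) :: real) \<in> borel_measurable M"
      unfolding of_bool_def by measurable
  show ?thesis
    by (rule integrable_bounded[where B = "B\<^sup>2"]) (auto simp: of_bool_def intro!: power_mono B)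
qed

lemma N_bounded:
  assumes "\<And>x. x \<in> {0..l} \<Longrightarrow> norm (\<phi> x) \<le> B"
  shows "norm (Nle x) \<le> B * measure M (space M)" "norm (Nlt x) \<le> B * measure M (space M)"
proof -
  have "B \<ge> 0" using assms[of 0] norm_ge_zero[of "\<phi> 0"] l_pos by (simp del: norm_ge_zero)
  then show "norm (Nle x) \<le> B * measure M (space M)" "norm (Nlt x) \<le> B * measure M (space M)"
    unfolding Nle_def Nlt_def using assms
    by (auto intro!: norm_integral_le simp: norm_mult of_bool_def)
qed

lemma measurable_N [measurable]: "Nle \<in> borel_measurable M" "Nlt \<in> borel_measurable M"
proof -
  have "(\<lambda>s. LINT r|M. of_bool (r \<le> s) * \<phi> r) \<in> borel_measurable M"
    "(\<lambda>s. LINT r|M. of_bool (r < s) * \<phi> r) \<in> borel_measurable M"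
    unfolding of_bool_def by measurable
  then show "Nle \<in> borel_measurable M" "Nlt \<in> borel_measurable M"
    unfolding Nle_def[abs_def] Nlt_def[abs_def] by auto
qed

text \<open>The kernel is the length of \<open>{max r s..<x}\<close>. Writing it as an integral over
  \<open>t\<close> links double integrals in \<open>M\<close> with the Lebesgue integral of
  \<open>|N(t)|\<^sup>2\<close>.\<close>

lemma overlap_integral:
  assumes "r \<in> {0..l}" "s \<in> {0..l}" "x \<in> {0..l}"
  shows "(LINT t|L. of_bool (r \<le> t \<and> s \<le> t \<and> t < x) :: complex) = complex_of_real (max 0 (x - max r s))"
proof -
  have "(LINT t|L. of_bool (r \<le> t \<and> s \<le> t \<and> t < x) :: complex) =
      (LINT t|L. complex_of_real (indicator {max r s..<x} t))"
    by (rule Bochner_Integration.integral_cong) (auto simp: indicator_def)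
  also have "\<dots> = complex_of_real (measure L {max r s..<x})"
    using assms by (simp add: space_L Int_absorb2 subset_eq)
  also have "measure L {max r s..<x} = measure lborel {max r s..<x}"
    using assms by (intro measure_L) auto
  also have "\<dots> = max 0 (x - max r s)"
    by (cases "max r s \<le> x") (auto simp: max_def)
  finally show ?thesis .
qed

text \<open>Expand \<open>|N(t)|\<^sup>2\<close> as a double integral over \<open>r \<le> t\<close>
  and \<open>s \<le> t\<close>, then apply Fubini twice to perform the integration in
  \<open>t\<close> first.\<close>

lemma Q_double_integral:
  assumes x: "x \<in> {0..l}"
  shows "complex_of_real (Q x) =
    (LINT r|M. cnj (\<phi> r) * (LINT s|M. complex_of_real (max 0 (x - max r s)) * \<phi> s))"
proof -
  obtain B where B: "B \<ge> 0" "\<And>x. x \<in> {0..l} \<Longrightarrow> norm (\<phi> x) \<le> B" using phi_bounded by blast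
  define C where "C = B * measure M (space M)"
  have C: "C \<ge> 0" "\<And>x. norm (Nle x) \<le> C" using N_bounded(1) B by (auto simp: C_def)
  have inner: "(LINT s|M. complex_of_real (max 0 (x - max r s)) * \<phi> s) =
      (LINT t|L. of_bool (r \<le> t \<and> t < x) * Nle t)" if r: "r \<in> {0..l}" for r
  proof -
    have "(LINT s|M. complex_of_real (max 0 (x - max r s)) * \<phi> s) =
        (LINT s|M. LINT t|L. of_bool (r \<le> t \<and> s \<le> t \<and> t < x) * \<phi> s)"
      using r x by (intro Bochner_Integration.integral_cong) (auto simp: space_M overlap_integral)
    also have "\<dots> = (LINT t|L. LINT s|M. of_bool (r \<le> t \<and> s \<le> t \<and> t < x) * \<phi> s)"
    proof (rule Fubini_bounded[where B = B])
      show "(\<lambda>(s, t). of_bool (r \<le> t \<and> s \<le> t \<and> t < x) * \<phi> s) \<in> borel_measurable (M \<Otimes>\<^sub>M L)"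
        unfolding of_bool_def by measurable
    qed (use B in \<open>auto simp: space_M norm_mult of_bool_def finite_L finite_measure_axioms\<close>)
    also have "\<dots> = (LINT t|L. of_bool (r \<le> t \<and> t < x) * Nle t)"
      unfolding Nle_def
      by (rule Bochner_Integration.integral_cong) (auto simp: of_bool_conj mult_ac)
    finally show ?thesis .
  qed
  have "(LINT r|M. cnj (\<phi> r) * (LINT s|M. complex_of_real (max 0 (x - max r s)) * \<phi> s)) =
      (LINT r|M. LINT t|L. cnj (\<phi> r) * (of_bool (r \<le> t \<and> t < x) * Nle t))"
    by (intro Bochner_Integration.integral_cong) (auto simp: space_M inner)
  also have "\<dots> = (LINT t|L. LINT r|M. cnj (\<phi> r) * (of_bool (r \<le> t \<and> t < x) * Nle t))"
  proof (rule Fubini_bounded[where B = "B * C"])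
    show "(\<lambda>(r, t). cnj (\<phi> r) * (of_bool (r \<le> t \<and> t < x) * Nle t)) \<in> borel_measurable (M \<Otimes>\<^sub>M L)"
      unfolding of_bool_def by measurable
  qed (use B C in \<open>auto simp: space_M norm_mult of_bool_def finite_L finite_measure_axioms intro!: mult_mono\<close>)
  also have "\<dots> = (LINT t|L. complex_of_real (of_bool (t < x) * (norm (Nle t))\<^sup>2))"
  proof (rule Bochner_Integration.integral_cong[OF refl])
    fix t
    have "(LINT r|M. cnj (\<phi> r) * (of_bool (r \<le> t \<and> t < x) * Nle t)) =
        (LINT r|M. (of_bool (t < x) * Nle t) * cnj (of_bool (r \<le> t) * \<phi> r))"
      by (rule Bochner_Integration.integral_cong) auto
    also have "\<dots> = (of_bool (t < x) * Nle t) * cnj (Nle t)"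
      unfolding Nle_def by (subst integral_mult_right_zero) (simp only: Bochner_Integration.integral_cnj)
    also have "\<dots> = complex_of_real (of_bool (t < x) * (norm (Nle t))\<^sup>2)"
      using complex_norm_square[of "Nle t"] by (simp add: mult_ac)
    finally show "(LINT r|M. cnj (\<phi> r) * (of_bool (r \<le> t \<and> t < x) * Nle t)) = \<dots>" .
  qed
  also have "\<dots> = complex_of_real (Q x)" unfolding Q_def by (rule integral_complex_of_real)
  finally show ?thesis by simp
qed

text \<open>The equation is tested against \<open>cnj \<phi>\<close> on \<open>[0, x]\<close>; whether the end point is included
  is irrelevant because \<open>\<phi> x - \<phi> r\<close> vanishes at \<open>r = x\<close>.\<close>

lemma energy_aux:
  assumes x: "x \<in> {0..l}"
  shows "(LINT r|M. of_bool (r < x) * (cnj (\<phi> r) * (\<phi> x - \<phi> r))) = k\<^sup>2 * complex_of_real (Q x)"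
proof -
  have "of_bool (r < x) * (cnj (\<phi> r) * (\<phi> x - \<phi> r)) =
     k\<^sup>2 * (cnj (\<phi> r) * (LINT s|M. complex_of_real (max 0 (x - max r s)) * \<phi> s))"
         if r: "r \<in> {0..l}" for r
  proof (cases "r < x")
    case True
    have "\<phi> x - \<phi> r = k\<^sup>2 * (LINT s|M. complex_of_real (max 0 (x - s)) * \<phi> s
        - complex_of_real (max 0 (r - s)) * \<phi> s)"
      using sol[OF x] sol[OF r]
      by (subst Bochner_Integration.integral_diff[OF integrable_kernel[OF cont] integrable_kernel[OF cont]])
        (simp add: algebra_simps)
    \<comment> \<open>For \<open>r < x\<close> the difference of the kernels at \<open>x\<close> and
      at \<open>r\<close> is the kernel of \<open>Q_double_integral\<close>.\<close>
    also have "(LINT s|M. complex_of_real (max 0 (x - s)) * \<phi> s -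
        complex_of_real (max 0 (r - s)) * \<phi> s) =
        (LINT s|M. complex_of_real (max 0 (x - max r s)) * \<phi> s)"
      using True by (intro Bochner_Integration.integral_cong) (auto simp: max_def algebra_simps)
    finally show ?thesis using True by simp
  next
    case False
    have "(LINT s|M. complex_of_real (max 0 (x - max r s)) * \<phi> s) = (LINT s|M. 0)"
      using False by (intro Bochner_Integration.integral_cong) (auto simp: max_def)
    then show ?thesis using False by simp
  qed
  then have "(LINT r|M. of_bool (r < x) * (cnj (\<phi> r) * (\<phi> x - \<phi> r))) =
     (LINT r|M. k\<^sup>2 * (cnj (\<phi> r) * (LINT s|M. complex_of_real (max 0 (x - max r s)) * \<phi> s)))"
    by (intro Bochner_Integration.integral_cong) (auto simp: space_M)
  then show ?thesis by (simp add: Q_double_integral[OF x])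
qed

text \<open>\<open>P\<close> sits between \<open>r < x\<close> and \<open>r \<le> x\<close>, so one
  proof covers both \<open>Nle\<close> and \<open>Nlt\<close>. The term with \<open>Q\<close> is the
  same in both cases.\<close>

lemma energy_identity:
  assumes x: "x \<in> {0..l}" and P [measurable]: "Measurable.pred M P" and
    "\<And>r. r < x \<Longrightarrow> P r" "\<And>r. P r \<Longrightarrow> r \<le> x"
  shows "\<phi> x * cnj (LINT r|M. of_bool (P r) * \<phi> r) =
    complex_of_real (LINT r|M. of_bool (P r) * (norm (\<phi> r))\<^sup>2) + k\<^sup>2 * complex_of_real (Q x)"
proof -
  have [measurable]: "(\<lambda>s. of_bool (P s) :: complex) \<in> borel_measurable M"
      unfolding of_bool_def by measurable
  have "integrable M (\<lambda>r. of_bool (P r) * \<phi> r)"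
    by (rule integrable_mult_phi[where C = 1]) (auto simp: of_bool_def)
  then have i: "integrable M (\<lambda>r. \<phi> x * cnj (of_bool (P r) * \<phi> r))"
    by (intro integrable_mult_right integrable_cnj)
  have j: "integrable M (\<lambda>r. complex_of_real (of_bool (P r) * (norm (\<phi> r))\<^sup>2))"
    by (intro integrable_of_real integrable_sqnorm) measurable
  have "of_bool (r < x) * (cnj (\<phi> r) * (\<phi> x - \<phi> r)) =
      \<phi> x * cnj (of_bool (P r) * \<phi> r) - complex_of_real (of_bool (P r) * (norm (\<phi> r))\<^sup>2)" for r
    using assms(3,4)[of r] complex_norm_square[of "\<phi> r"]
    by (cases r x rule: linorder_cases) (auto simp: of_bool_def algebra_simps)
  then have "k\<^sup>2 * complex_of_real (Q x) =
     (LINT r|M. \<phi> x * cnj (of_bool (P r) * \<phi> r) - complex_of_real (of_bool (P r) * (norm (\<phi> r))\<^sup>2))"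
    unfolding energy_aux[OF x, symmetric] by simp
  also have "\<dots> = (LINT r|M. \<phi> x * cnj (of_bool (P r) * \<phi> r)) -
      (LINT r|M. complex_of_real (of_bool (P r) * (norm (\<phi> r))\<^sup>2))"
    by (rule Bochner_Integration.integral_diff[OF i j])
  also have "(LINT r|M. \<phi> x * cnj (of_bool (P r) * \<phi> r)) = \<phi> x * cnj (LINT r|M. of_bool (P r) * \<phi> r)"
    by (simp only: integral_mult_right_zero Bochner_Integration.integral_cnj)
  finally show ?thesis by (simp only: integral_complex_of_real) (simp add: algebra_simps)
qed

lemma energy_le:
  assumes x: "x \<in> {0..l}"
  shows "\<phi> x * cnj (Nle x) = complex_of_real (Ale x) + k\<^sup>2 * complex_of_real (Q x)"
  unfolding Nle_def Ale_def by (rule energy_identity[OF x]) auto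

lemma energy_lt:
  assumes x: "x \<in> {0..l}"
  shows "\<phi> x * cnj (Nlt x) = complex_of_real (Alt x) + k\<^sup>2 * complex_of_real (Q x)"
  unfolding Nlt_def Alt_def by (rule energy_identity[OF x]) auto

lemma Q_nonneg: "Q x \<ge> 0"
  unfolding Q_def by (rule Bochner_Integration.integral_nonneg) simp

lemma Ale_nonneg: "Ale x \<ge> 0" and Alt_nonneg: "Alt x \<ge> 0"
  unfolding Ale_def Alt_def by (auto intro!: Bochner_Integration.integral_nonneg)

lemma Alt_le_Ale: "Alt x \<le> Ale x"
  unfolding Ale_def Alt_def by (intro integral_mono integrable_sqnorm) auto

lemma Ale_le_Alt: "t < x \<Longrightarrow> Ale t \<le> Alt x"
  unfolding Ale_def Alt_def by (intro integral_mono integrable_sqnorm) auto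

lemma Nle_sq_le: "(norm (Nle x))\<^sup>2 \<le> measure M (space M) * Ale x"
proof -
  obtain B where B: "B \<ge> 0" "\<And>x. x \<in> {0..l} \<Longrightarrow> norm (\<phi> x) \<le> B" using phi_bounded by blast
  have "(norm (Nle x))\<^sup>2 \<le> measure M (space M) * (LINT s|M. (norm (of_bool (s \<le> x) * \<phi> s))\<^sup>2)"
    unfolding Nle_def by (rule Cauchy_Schwarz_integral[where B = B]) (auto simp: norm_mult of_bool_def B)
  also have "(LINT s|M. (norm (of_bool (s \<le> x) * \<phi> s))\<^sup>2) = Ale x"
    unfolding Ale_def by (rule Bochner_Integration.integral_cong) auto
  finally show ?thesis .
qed

text \<open>For \<open>t < x\<close>, Cauchy-Schwarz bounds \<open>|N(t)|\<^sup>2\<close> by the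
  mass times \<open>Ale t\<close>, which is at most \<open>Alt x\<close>. Having \<open>Alt\<close>
  in place of \<open>Ale\<close> leaves the contribution of an atom at \<open>x\<close> to spare,
  and the equality case uses it.\<close>

lemma Q_le:
  assumes x: "x \<in> {0..l}"
  shows "Q x \<le> x * (measure M (space M) * Alt x)"
proof -
  interpret L: finite_measure L by (rule finite_L)
  obtain C where C: "\<And>x. norm (Nle x) \<le> C" using N_bounded(1) phi_bounded by blast
  have ind: "{0..<x} \<in> sets L" using x by (intro in_sets_L) auto
  have "Q x \<le> (LINT t|L. indicator {0..<x} t * (measure M (space M) * Alt x))"
    unfolding Q_def
  proof (rule integral_mono)
    show "integrable L (\<lambda>t. of_bool (t < x) * (norm (Nle t))\<^sup>2)"
      unfolding of_bool_def
      by (rule L.integrable_const_bound[where B = "C\<^sup>2"]) (auto intro!: power_mono C)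
    show "integrable L (\<lambda>t. indicator {0..<x} t * (measure M (space M) * Alt x))"
      using ind by (intro integrable_mult_left integrable_real_indicator) (auto simp: less_top[symmetric])
  next
    fix t assume "t \<in> space L"
    moreover have "(norm (Nle t))\<^sup>2 \<le> measure M (space M) * Alt x" if "t < x"
      using Nle_sq_le[of t] mult_left_mono[OF Ale_le_Alt[OF that], of "measure M (space M)"] by simp
    ultimately show "of_bool (t < x) * (norm (Nle t))\<^sup>2 \<le>
        indicator {0..<x} t * (measure M (space M) * Alt x)"
      by (auto simp: space_L)
  qed
  also have "\<dots> = measure L {0..<x} * (measure M (space M) * Alt x)"
    using ind by (subst integral_mult_left_zero) (use x in \<open>simp add: Int_absorb2 space_L subset_eq\<close>)
  also have "measure L {0..<x} = measure lborel {0..<x}"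
    using x by (intro measure_L) auto
  also have "\<dots> = x" using x by simp
  finally show ?thesis .
qed

text \<open>This is the integral over \<open>[0, l]\<close> of \<open>x d|N(x)|\<^sup>2\<close>; at an atom of \<open>M\<close> the increment of
  \<open>|N|\<^sup>2\<close> involves the mean of the one-sided limits of \<open>N\<close>, whence both \<open>Nle\<close> and \<open>Nlt\<close>.\<close>

lemma virial_identity:
  "l * (norm (Nle l))\<^sup>2 - Q l = (LINT s|M. s * Re (\<phi> s * cnj (Nle s) + \<phi> s * cnj (Nlt s)))"
proof -
  obtain B where B: "B \<ge> 0" "\<And>x. x \<in> {0..l} \<Longrightarrow> norm (\<phi> x) \<le> B" using phi_bounded by blast
  have l: "l \<in> {0..l}" using l_pos by simp
  have Nl: "Nle l = (LINT s|M. \<phi> s)" unfolding Nle_def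
    by (rule Bochner_Integration.integral_cong) (auto simp: space_M)
  have ic: "integrable M (\<lambda>r. cnj (\<phi> r))"
    using integrable_mult_phi[of "\<lambda>_. 1" 1] by (intro integrable_cnj) simp
  let ?I = "\<lambda>r. LINT s|M. complex_of_real (max 0 (l - max r s)) * \<phi> s"
  let ?J = "\<lambda>r. LINT s|M. of_bool (r < s) * (complex_of_real s * \<phi> s)"
  \<comment> \<open>On \<open>[0, l]\<close>, \<open>l\<close> minus the kernel
    \<open>max 0 (l - max r s)\<close> is \<open>max r s\<close>. The integral over \<open>s\<close>
    is split according to which of \<open>r\<close> and \<open>s\<close> is the larger.\<close>
  have J: "complex_of_real l * Nle l - ?I r = complex_of_real r * Nle r + ?J r" if r: "r \<in> {0..l}" for r
  proof -
    have i1: "integrable M (\<lambda>s. complex_of_real l * \<phi> s)"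
      by (rule integrable_mult_phi[where C = l]) (use l_pos in auto)
    have i2: "integrable M (\<lambda>s. complex_of_real (max 0 (l - max r s)) * \<phi> s)"
      by (rule integrable_mult_phi[where C = l])
        (use l_pos r in \<open>auto simp: max_def norm_of_real simp del: of_real_diff\<close>)
    have i3: "integrable M (\<lambda>s. of_bool (s \<le> r) * \<phi> s)"
      by (rule integrable_mult_phi[where C = 1]) auto
    have i4: "integrable M (\<lambda>s. (of_bool (r < s) * complex_of_real s) * \<phi> s)"
      by (rule integrable_mult_phi[where C = l]) (auto simp: norm_mult of_bool_def l_pos less_imp_le)
    have "complex_of_real l * Nle l - ?I r =
        (LINT s|M. complex_of_real l * \<phi> s - complex_of_real (max 0 (l - max r s)) * \<phi> s)"
      unfolding Nl Bochner_Integration.integral_diff[OF i1 i2] by simp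
    also have "\<dots> = (LINT s|M. complex_of_real r * (of_bool (s \<le> r) * \<phi> s) +
        (of_bool (r < s) * complex_of_real s) * \<phi> s)"
      using r by (intro Bochner_Integration.integral_cong) (auto simp: space_M max_def of_bool_def algebra_simps)
    also have "\<dots> = complex_of_real r * Nle r + ?J r"
      unfolding Nle_def using i3 i4 by (simp add: mult.assoc)
    finally show ?thesis .
  qed
  have meas_NJ: "(\<lambda>r. LINT s|M. of_bool (r < s) * (complex_of_real s * \<phi> s)) \<in> borel_measurable M"
    "(\<lambda>r. LINT s|M. complex_of_real (max 0 (l - max r s)) * \<phi> s) \<in> borel_measurable M"
    unfolding of_bool_def by measurable
  have bN: "norm (Nle x) \<le> B * measure M (space M)" "norm (Nlt x) \<le> B * measure M (space M)" for x
    using N_bounded B(2) by blast+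
  have bI: "norm (?I r) \<le> l * B * measure M (space M)" if "r \<in> {0..l}" for r
    using that B l_pos by (intro norm_integral_le) (auto simp: norm_mult max_def simp del: of_real_diff intro!: mult_mono)
  have bJ: "norm (?J r) \<le> l * B * measure M (space M)" if "r \<in> {0..l}" for r
    using that B l_pos by (intro norm_integral_le) (auto simp: norm_mult of_bool_def intro!: mult_mono)
  have i5: "integrable M (\<lambda>r. cnj (\<phi> r) * (complex_of_real l * Nle l))"
    using ic by (rule integrable_mult_left)
  have i6: "integrable M (\<lambda>r. cnj (\<phi> r) * ?I r)"
    using meas_NJ(2) B bI l_pos
    by (intro integrable_bounded[where B = "B * (l * B * measure M (space M))"])
      (auto simp: norm_mult intro!: mult_mono)
  have i7: "integrable M (\<lambda>r. complex_of_real r * (cnj (\<phi> r) * Nle r))"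
    using B bN l_pos
    by (intro integrable_bounded[where B = "l * (B * (B * measure M (space M)))"])
      (auto simp: norm_mult intro!: mult_mono)
  have i8: "integrable M (\<lambda>r. cnj (\<phi> r) * ?J r)"
    using meas_NJ(1) B bJ l_pos
    by (intro integrable_bounded[where B = "B * (l * B * measure M (space M))"])
      (auto simp: norm_mult intro!: mult_mono)
  have i9: "integrable M (\<lambda>r. complex_of_real r * (\<phi> r * cnj (Nlt r)))"
    using B bN l_pos
    by (intro integrable_bounded[where B = "l * (B * (B * measure M (space M)))"])
      (auto simp: norm_mult intro!: mult_mono)
  \<comment> \<open>In the half \<open>r < s\<close> the order of integration is exchanged so that
    the larger variable is outermost again. The diagonal was already counted in \<open>Nle\<close>,
    hence \<open>Nlt\<close> here.\<close>
  have swap: "(LINT r|M. cnj (\<phi> r) * ?J r) = (LINT s|M. complex_of_real s * (\<phi> s * cnj (Nlt s)))"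
  proof -
    have "(LINT r|M. cnj (\<phi> r) * ?J r) =
        (LINT r|M. LINT s|M. cnj (\<phi> r) * (of_bool (r < s) * (complex_of_real s * \<phi> s)))"
      by simp
    also have "\<dots> = (LINT s|M. LINT r|M. cnj (\<phi> r) * (of_bool (r < s) * (complex_of_real s * \<phi> s)))"
    proof (rule Fubini_bounded[where B = "B * (l * B)"])
      show "(\<lambda>(r, s). cnj (\<phi> r) * (of_bool (r < s) * (complex_of_real s * \<phi> s))) \<in> borel_measurable (M \<Otimes>\<^sub>M M)"
        unfolding of_bool_def by measurable
    qed (use B l_pos in \<open>auto simp: space_M norm_mult of_bool_def finite_measure_axioms intro!: mult_mono\<close>)
    also have "\<dots> = (LINT s|M. complex_of_real s * (\<phi> s * cnj (Nlt s)))"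
    proof (rule Bochner_Integration.integral_cong[OF refl])
      fix s
      have "(LINT r|M. cnj (\<phi> r) * (of_bool (r < s) * (complex_of_real s * \<phi> s))) =
        (LINT r|M. (complex_of_real s * \<phi> s) * cnj (of_bool (r < s) * \<phi> r))"
        by (rule Bochner_Integration.integral_cong) auto
      also have "\<dots> = complex_of_real s * (\<phi> s * cnj (Nlt s))"
        unfolding Nlt_def by (subst integral_mult_right_zero) (simp only: Bochner_Integration.integral_cnj mult.assoc)
      finally show "(LINT r|M. cnj (\<phi> r) * (of_bool (r < s) * (complex_of_real s * \<phi> s))) = \<dots>" .
    qed
    finally show ?thesis .
  qed
  have "complex_of_real (l * (norm (Nle l))\<^sup>2 - Q l) =
     (LINT r|M. cnj (\<phi> r)) * (complex_of_real l * Nle l) - (LINT r|M. cnj (\<phi> r) * ?I r)"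
    using complex_norm_square[of "Nle l"] unfolding Q_double_integral[OF l, symmetric]
    by (simp add: Nl mult_ac)
  also have "\<dots> = (LINT r|M. cnj (\<phi> r) * (complex_of_real l * Nle l) - cnj (\<phi> r) * ?I r)"
    unfolding Bochner_Integration.integral_diff[OF i5 i6] by (subst integral_mult_left_zero) simp
  also have "\<dots> = (LINT r|M. complex_of_real r * (cnj (\<phi> r) * Nle r) + cnj (\<phi> r) * ?J r)"
  proof (rule Bochner_Integration.integral_cong[OF refl])
    fix r assume "r \<in> space M"
    then have "cnj (\<phi> r) * (complex_of_real l * Nle l - ?I r) =
        cnj (\<phi> r) * (complex_of_real r * Nle r + ?J r)"
      by (simp only: J space_M)
    then show "cnj (\<phi> r) * (complex_of_real l * Nle l) - cnj (\<phi> r) * ?I r =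
        complex_of_real r * (cnj (\<phi> r) * Nle r) + cnj (\<phi> r) * ?J r"
      by (simp only: right_diff_distrib distrib_left mult_ac)
  qed
  also have "\<dots> = (LINT r|M. complex_of_real r * (cnj (\<phi> r) * Nle r) + complex_of_real r * (\<phi> r * cnj (Nlt r)))"
    unfolding Bochner_Integration.integral_add[OF i7 i8] Bochner_Integration.integral_add[OF i7 i9] swap ..
  finally have "l * (norm (Nle l))\<^sup>2 - Q l =
      Re (LINT r|M. complex_of_real r * (cnj (\<phi> r) * Nle r) + complex_of_real r * (\<phi> r * cnj (Nlt r)))"
    by (metis Re_complex_of_real)
  also have "\<dots> = (LINT r|M. Re (complex_of_real r * (cnj (\<phi> r) * Nle r) + complex_of_real r * (\<phi> r * cnj (Nlt r))))"
    by (rule integral_Re[symmetric]) (rule Bochner_Integration.integrable_add[OF i7 i9])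
  also have "\<dots> = (LINT s|M. s * Re (\<phi> s * cnj (Nle s) + \<phi> s * cnj (Nlt s)))"
    by (rule Bochner_Integration.integral_cong) (auto simp: algebra_simps)
  finally show ?thesis .
qed


subsection \<open>The inequalities and their equality cases\<close>

lemma integrable_virial:
  "integrable M (\<lambda>s. s * Re (\<phi> s * cnj (Nle s) + \<phi> s * cnj (Nlt s)))"
proof -
  obtain B where B: "B \<ge> 0" "\<And>x. x \<in> {0..l} \<Longrightarrow> norm (\<phi> x) \<le> B" using phi_bounded by blast
  let ?C = "B * measure M (space M)"
  have "\<bar>Re (\<phi> s * cnj (Nle s) + \<phi> s * cnj (Nlt s))\<bar> \<le> B * ?C + B * ?C" if "s \<in> {0..l}" for s
    using N_bounded[OF B(2)] B that
    by (intro order_trans[OF abs_Re_le_cmod norm_triangle_le] add_mono)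
      (auto simp: norm_mult intro!: mult_mono)
  then show ?thesis
    using l_pos B(1)
    by (intro integrable_bounded[where B = "l * (B * ?C + B * ?C)"])
      (auto simp: abs_mult simp del: plus_complex.sel times_complex.sel intro!: mult_mono)
qed

lemma Re_energy:
  assumes "s \<in> {0..l}"
  shows "Re (\<phi> s * cnj (Nle s) + \<phi> s * cnj (Nlt s)) =
    Ale s + Alt s + 2 * ((Re k)\<^sup>2 - (Im k)\<^sup>2) * Q s"
  using energy_le[OF assms] energy_lt[OF assms]
  by (simp del: times_complex.sel add: Re_power2) (simp add: power2_eq_square algebra_simps)

section \<open>Positivity of the virial density\<close>

context
  fixes m :: real
  assumes m_pos: "m > 0" and mass_le: "measure M (space M) \<le> m" and freq: "(Im k)\<^sup>2 * (m * l) \<le> 1"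
begin

text \<open>Only the term with \<open>(Im k)\<^sup>2\<close> is negative, and \<open>Q_le\<close>
  absorbs it into \<open>Alt\<close>. The three summands on the left are separately nonnegative on
  \<open>[0, l]\<close> by \<open>freq_at\<close>; all are kept so that equality can be read off
  from each.\<close>

lemma energy_density_lower:
  assumes s: "s \<in> {0..l}"
  shows "(Ale s - Alt s) + 2 * Alt s * (1 - (Im k)\<^sup>2 * (m * s)) + 2 * (Re k)\<^sup>2 * Q s
    \<le> Re (\<phi> s * cnj (Nle s) + \<phi> s * cnj (Nlt s))"
proof -
  have "Q s \<le> s * (measure M (space M) * Alt s)" by (rule Q_le[OF s])
  also have "\<dots> \<le> s * (m * Alt s)"
    using s mass_le Alt_nonneg by (intro mult_left_mono mult_right_mono) auto
  finally have "(Im k)\<^sup>2 * Q s \<le> (Im k)\<^sup>2 * (s * (m * Alt s))" by (rule mult_left_mono) simp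
  then show ?thesis unfolding Re_energy[OF s] by (simp add: algebra_simps)
qed

text \<open>Strictness to the left of \<open>l\<close> persists at the extreme frequency
  \<open>(Im k)\<^sup>2 * (m * l) = 1\<close>. Only the point \<open>l\<close> itself is then left
  for a separate argument.\<close>

lemma freq_at:
  assumes "s \<in> {0..l}"
  shows "(Im k)\<^sup>2 * (m * s) \<le> 1" "s < l \<Longrightarrow> (Im k)\<^sup>2 * (m * s) < 1"
proof -
  have "(Im k)\<^sup>2 * (m * s) \<le> (Im k)\<^sup>2 * (m * l)"
    using assms m_pos by (intro mult_left_mono) auto
  with freq show "(Im k)\<^sup>2 * (m * s) \<le> 1" by linarith
  show "(Im k)\<^sup>2 * (m * s) < 1" if "s < l"
  proof (cases "Im k = 0")
    case False
    then have "(Im k)\<^sup>2 * (m * s) < (Im k)\<^sup>2 * (m * l)"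
      using that m_pos by (intro mult_strict_left_mono) auto
    with freq show ?thesis by linarith
  qed simp
qed

lemma energy_density_nonneg:
  assumes s: "s \<in> {0..l}"
  shows "Re (\<phi> s * cnj (Nle s) + \<phi> s * cnj (Nlt s)) \<ge> 0"
proof -
  have "0 \<le> Alt s * (1 - (Im k)\<^sup>2 * (m * s))" "0 \<le> (Re k)\<^sup>2 * Q s"
    using freq_at(1)[OF s] Alt_nonneg[of s] Q_nonneg[of s] by auto
  with energy_density_lower[OF s] Alt_le_Ale[of s] show ?thesis by linarith
qed

lemma Q_le_end: "Q l \<le> l * (norm (Nle l))\<^sup>2"
proof -
  have "0 \<le> (LINT s|M. s * Re (\<phi> s * cnj (Nle s) + \<phi> s * cnj (Nlt s)))"
    by (rule integral_nonneg_AE, rule AE_I2, rule mult_nonneg_nonneg)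
      (use energy_density_nonneg in \<open>auto simp: space_M simp del: plus_complex.sel times_complex.sel\<close>)
  then show ?thesis unfolding virial_identity[symmetric] by simp
qed

end

section \<open>Equality cases: locating the mass\<close>

lemma Ale_eq_0:
  assumes "Ale x = 0"
  shows "AE r in M. r \<le> x \<longrightarrow> \<phi> r = 0"
proof -
  have "AE r in M. of_bool (r \<le> x) * (norm (\<phi> r))\<^sup>2 = 0"
    using assms unfolding Ale_def
    by (subst (asm) integral_nonneg_eq_0_iff_AE) (auto intro!: integrable_sqnorm)
  then show ?thesis by eventually_elim auto
qed

lemma phi_eq_1:
  assumes "Ale x = 0" "x \<in> {0..l}"
  shows "\<phi> x = 1"
proof -
  have "(LINT s|M. complex_of_real (max 0 (x - s)) * \<phi> s) = (LINT s|M. 0)"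
    using Ale_eq_0[OF assms(1)] by (intro integral_cong_AE) (auto simp: max_def)
  then show ?thesis using sol[OF assms(2)] by simp
qed

lemma Ale_mono: "x \<le> y \<Longrightarrow> Ale x \<le> Ale y"
  unfolding Ale_def by (intro integral_mono integrable_sqnorm) auto

text \<open>If \<open>A(x)\<close> vanishes, then \<open>\<phi>\<close> is 0 almost everywhere on
  \<open>[0, x]\<close>, yet equal to 1 at each of its points. Hence \<open>[0, x]\<close> carries
  no mass.\<close>

lemma Ale_eq_0_null:
  assumes "Ale x = 0"
  shows "AE r in M. x < r"
  using Ale_eq_0[OF assms] AE_space
proof eventually_elim
  case (elim r)
  show ?case
  proof (rule ccontr)
    assume "\<not> x < r"
    then have "Ale r = 0" using Ale_mono[of r x] Ale_nonneg[of r] assms by simp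
    with elim \<open>\<not> x < r\<close> show False using phi_eq_1[of r] by (simp add: space_M)
  qed
qed

end

text \<open>The points \<open>s\<close> for which \<open>[0, s]\<close> is null form an initial
  segment \<open>T\<close>. It is null itself: directly if it contains its supremum, and otherwise
  as a countable union of null intervals \<open>[0, f n]\<close>.\<close>

lemma (in krein_string) AE_not_before_support:
  "AE s in M. \<not> (AE r in M. s < r)"
proof -
  define T where "T = {s\<in>{0..l}. AE r in M. s < r}"
  have bdd: "bdd_above T" by (rule bdd_aboveI[of _ l]) (auto simp: T_def)
  have "AE s in M. s \<notin> T"
  proof (cases "T = {}")
    case False
    define a where "a = Sup T"
    have up: "s \<le> a" if "s \<in> T" for s unfolding a_def using that bdd by (rule cSup_upper)
    show ?thesis
    proof (cases "a \<in> T")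
      case True
      then have "AE r in M. a < r" by (simp add: T_def)
      then show ?thesis by eventually_elim (use up in force)
    next
      case False
      have "\<exists>s\<in>T. a - 1 / real (Suc n) < s" for n
        using less_cSup_iff[OF \<open>T \<noteq> {}\<close> bdd, of "a - 1 / real (Suc n)"] by (simp add: a_def)
      then obtain f where f: "\<And>n. f n \<in> T" "\<And>n. a - 1 / real (Suc n) < f n" by metis
      have "AE r in M. \<forall>n. f n < r"
        using f(1) by (subst AE_all_countable) (simp add: T_def)
      then show ?thesis
      proof eventually_elim
        case (elim r)
        show ?case
        proof
          assume r: "r \<in> T"
          with up False have "r < a" by (metis less_le)
          then obtain n where "1 / real (Suc n) < a - r"
              using reals_Archimedean[of "a - r"] by (auto simp: inverse_eq_divide)
          with f(2)[of n] elim show False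
              by (metis diff_less_eq less_diff_eq order_less_trans order_less_irrefl add.commute)
        qed
      qed
    qed
  qed simp
  then show ?thesis using AE_space by eventually_elim (auto simp: T_def space_M)
qed

context krein_solution
begin

text \<open>Equality makes the virial integral zero, so its nonnegative integrand vanishes almost
  everywhere. The factor \<open>s\<close> says nothing at 0; every other point is to be
  excluded.\<close>

lemma Q_eq_end_imp_concentrated:
  assumes m: "m > 0" "measure M (space M) \<le> m" "(Im k)\<^sup>2 * (m * l) \<le> 1"
    and eq: "Q l = l * (norm (Nle l))\<^sup>2" and pos: "Q l > 0" "Re k \<noteq> 0"
  shows "AE s in M. s = 0"
proof -
  have "AE s in M. s * Re (\<phi> s * cnj (Nle s) + \<phi> s * cnj (Nlt s)) = 0"
  proof (subst integral_nonneg_eq_0_iff_AE[symmetric])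
    show "integrable M (\<lambda>s. s * Re (\<phi> s * cnj (Nle s) + \<phi> s * cnj (Nlt s)))" by (rule integrable_virial)
    show "AE s in M. 0 \<le> s * Re (\<phi> s * cnj (Nle s) + \<phi> s * cnj (Nlt s))"
      by (rule AE_I2, rule mult_nonneg_nonneg)
        (use energy_density_nonneg[OF m] in \<open>auto simp: space_M simp del: plus_complex.sel times_complex.sel\<close>)
    show "(LINT s|M. s * Re (\<phi> s * cnj (Nle s) + \<phi> s * cnj (Nlt s))) = 0"
      using eq unfolding virial_identity[symmetric] by simp
  qed
  with AE_not_before_support AE_space show ?thesis
  proof eventually_elim
    case (elim s)
    then have s: "s \<in> {0..l}" by (simp add: space_M)
    show ?case
    proof (rule ccontr)
      assume "s \<noteq> 0"
      with elim have *: "Re (\<phi> s * cnj (Nle s) + \<phi> s * cnj (Nlt s)) = 0" by simp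
      have ge: "0 \<le> Alt s * (1 - (Im k)\<^sup>2 * (m * s))" "0 \<le> (Re k)\<^sup>2 * Q s"
        using freq_at(1)[OF m s] Alt_nonneg[of s] Q_nonneg[of s] by auto
      \<comment> \<open>All three summands of \<open>energy_density_lower\<close> vanish. For
        \<open>s < l\<close> the strict frequency bound then gives \<open>Ale s = 0\<close>, so
        \<open>s\<close> precedes the support. For \<open>s = l\<close> the vanishing of
        \<open>(Re k)\<^sup>2 * Q l\<close> contradicts the hypotheses.\<close>
      have zero: "Ale s = Alt s" "Alt s * (1 - (Im k)\<^sup>2 * (m * s)) = 0" "(Re k)\<^sup>2 * Q s = 0"
        using ge energy_density_lower[OF m s] Alt_le_Ale[of s] unfolding * by linarith+
      show False
      proof (cases "s < l")
        case True
        then have "Ale s = 0" using zero freq_at(2)[OF m s] by auto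
        then show False using Ale_eq_0_null elim by blast
      next
        case False
        then have "s = l" using s by simp
        then show False using zero pos by simp
      qed
    qed
  qed
qed

lemma Nle_end: "Nle l = (LINT s|M. \<phi> s)"
  unfolding Nle_def by (rule Bochner_Integration.integral_cong) (auto simp: space_M)

lemma Ale_end: "Ale l = (LINT s|M. (norm (\<phi> s))\<^sup>2)"
  unfolding Ale_def by (rule Bochner_Integration.integral_cong) (auto simp: space_M)

text \<open>Equality gives full mass and \<open>\<phi> = c\<close> almost everywhere with
  \<open>c \<noteq> 0\<close>. That the mass sits at one point comes from the equation: mass to the
  left of two points of the level set would change \<open>\<phi>\<close> between them.\<close>

lemma Cauchy_Schwarz_eq_imp_concentrated:
  assumes m: "measure M (space M) \<le> m"
    and eq: "(norm (Nle l))\<^sup>2 = m * Ale l" and pos: "Ale l > 0" "m > 0"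
    and k: "k \<noteq> 0"
  shows "measure M (space M) = m \<and> (\<exists>b\<in>{0..l}. AE s in M. s = b)"
proof -
  obtain B where B: "B \<ge> 0" "\<And>x. x \<in> {0..l} \<Longrightarrow> norm (\<phi> x) \<le> B" using phi_bounded by blast
  have "m * Ale l \<le> measure M (space M) * Ale l" using Nle_sq_le[of l] eq by simp
  with pos m have mass: "measure M (space M) = m" by simp
  define c where "c = Nle l / m"
  have "norm (Nle l) \<noteq> 0" using eq pos by auto
  then have c: "c \<noteq> 0" using pos by (simp add: c_def)
  have "(LINT s|M. (norm (complex_of_real m * \<phi> s - Nle l))\<^sup>2) = 0"
    using variance_identity[OF measurable_phi B(2)] eq unfolding Nle_end Ale_end mass by simp
  moreover have "integrable M (\<lambda>s. (norm (complex_of_real m * \<phi> s - Nle l))\<^sup>2)"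
    using B pos
    by (intro integrable_bounded[where B = "(m * B + norm (Nle l))\<^sup>2"])
      (auto simp: norm_mult intro!: power_mono order_trans[OF norm_triangle_ineq4] mult_left_mono)
  ultimately have "AE s in M. (norm (complex_of_real m * \<phi> s - Nle l))\<^sup>2 = 0"
    by (subst (asm) integral_nonneg_eq_0_iff_AE) auto
  then have const: "AE s in M. \<phi> s = c"
    by eventually_elim (use pos in \<open>simp add: c_def field_simps\<close>)
  define E where "E = {x\<in>{0..l}. \<phi> x = c}"
  have AE_E: "AE s in M. s \<in> E" using const AE_space by eventually_elim (simp add: E_def space_M)
  have "E \<noteq> {}"
  proof
    assume "E = {}"
    with AE_E have "AE s in M. False" by simp
    then have "(LINT s|M. 1 :: real) = (LINT s|M. 0)" by (intro integral_cong_AE) auto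
    then have "measure M (space M) = 0" by simp
    with mass pos show False by simp
  qed
  have "closed E" unfolding E_def
    using continuous_closed_preimage_constant[OF cont closed_atLeastAtMost] by simp
  have bdd: "bdd_above E" by (rule bdd_aboveI[of _ l]) (auto simp: E_def)
  \<comment> \<open>The last point of the closed level set \<open>E\<close>. Almost no mass lies to
    its right, and the rest of the proof excludes mass to its left.\<close>
  define b where "b = Sup E"
  have b: "b \<in> E" unfolding b_def by (rule closed_contains_Sup) fact+
  have up: "x \<le> b" if "x \<in> E" for x unfolding b_def using that bdd by (rule cSup_upper)
  have "AE s in M. b \<le> s"
  proof (cases "E = {b}")
    case True
    with AE_E show ?thesis by (auto elim!: eventually_mono)
  next
    case False
    then obtain x where x: "x \<in> E" "x < b"
      using b up by (metis insertI1 less_le singletonD subsetI subset_antisym empty_subsetI insert_subset)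
    have in_l: "x \<in> {0..l}" "b \<in> {0..l}" "\<phi> x = \<phi> b" using x b by (auto simp: E_def)
    \<comment> \<open>Nonnegative, and positive exactly for \<open>s < b\<close>. Its integral
      vanishes because \<open>\<phi> x = \<phi> b\<close>, \<open>k \<noteq> 0\<close> and
      \<open>c \<noteq> 0\<close>.\<close>
    let ?h = "\<lambda>s. max 0 (b - s) - max 0 (x - s)"
    have "k\<^sup>2 * (LINT s|M. complex_of_real (max 0 (b - s)) * \<phi> s -
        complex_of_real (max 0 (x - s)) * \<phi> s) = 0"
      using sol[OF in_l(1)] sol[OF in_l(2)] in_l(3)
      by (subst Bochner_Integration.integral_diff[OF integrable_kernel[OF cont] integrable_kernel[OF cont]])
        (simp add: algebra_simps)
    moreover have "(LINT s|M. complex_of_real (max 0 (b - s)) * \<phi> s -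
        complex_of_real (max 0 (x - s)) * \<phi> s) =
        (LINT s|M. complex_of_real (?h s) * c)"
    proof (rule integral_cong_AE)
      show "AE s in M. complex_of_real (max 0 (b - s)) * \<phi> s - complex_of_real (max 0 (x - s)) * \<phi> s =
          complex_of_real (?h s) * c"
        using const by eventually_elim (simp add: algebra_simps)
    qed measurable
    ultimately have "(LINT s|M. complex_of_real (?h s)) = 0" using k c by simp
    then have "(LINT s|M. ?h s) = 0" by (simp only: integral_complex_of_real of_real_eq_0_iff)
    moreover have "integrable M ?h"
      using in_l x by (intro integrable_bounded[where B = "2 * l"]) (auto simp: max_def)
    moreover have "AE s in M. 0 \<le> ?h s" using x by (auto simp: max_def)
    ultimately have "AE s in M. ?h s = 0" by (subst (asm) integral_nonneg_eq_0_iff_AE) auto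
    then show ?thesis by eventually_elim (use x in \<open>auto simp: max_def split: if_splits\<close>)
  qed
  with AE_E have "AE s in M. s = b" by eventually_elim (use up in force)
  moreover have "b \<in> {0..l}" using b by (simp add: E_def)
  ultimately show ?thesis using mass by blast
qed

end


subsection \<open>Point strings\<close>

lemma (in krein_string) concentrated_imp_point_string:
  assumes "AE s in M. s = b" "b \<in> {0..l}"
  shows "M = point_string l (measure M (space M)) b"
proof (rule measure_eqI)
  show "sets M = sets (point_string l (measure M (space M)) b)"
    by (simp add: point_string_def sets_M)
  fix A assume A: "A \<in> sets M"
  have "emeasure M A = (if b \<in> A then emeasure M (space M) else 0)"
  proof (cases "b \<in> A")
    case True
    then show ?thesis using assms A sets.top[of M]
        by (auto intro!: emeasure_eq_AE elim!: eventually_mono simp: space_M)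
  next
    case False
    then have "emeasure M A = emeasure M {}"
        using assms(1) A by (intro emeasure_eq_AE) (auto elim!: eventually_mono)
    then show ?thesis using False by simp
  qed
  also have "\<dots> = emeasure (point_string l (measure M (space M)) b) A"
    using A by (simp add: point_string_def sets_M emeasure_eq_measure)
  finally show "emeasure M A = emeasure (point_string l (measure M (space M)) b) A" .
qed

lemma emeasure_point_string:
  assumes "A \<in> sets borel" "A \<subseteq> {0..l}"
  shows "emeasure (point_string l \<mu> b) A = ennreal \<mu> * indicator A b"
proof -
  have "A \<in> sets (restrict_space borel {0..l})" using assms by (auto simp: sets_restrict_space)
  then show ?thesis by (simp add: point_string_def)
qed

lemma space_point_string: "space (point_string l \<mu> b) = {0..l}"
  by (simp add: point_string_def space_scale_measure space_restrict_space)

lemma is_string_point_string: "is_string l (point_string l \<mu> b)"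
proof -
  have "emeasure (point_string l \<mu> b) {0..l} \<noteq> \<infinity>"
    by (subst emeasure_point_string) (auto simp: indicator_def)
  then show ?thesis unfolding is_string_def
    by (auto intro!: finite_measureI simp: space_point_string) (auto simp: point_string_def)
qed

lemma integral_point_string:
  fixes f :: "real \<Rightarrow> complex"
  assumes b: "b \<in> {0..l}" "l > 0" and \<mu>: "\<mu> \<ge> 0" and f: "continuous_on {0..l} f"
  shows "(LINT s|point_string l \<mu> b. f s) = \<mu> * f b"
proof -
  let ?M = "point_string l \<mu> b"
  interpret krein_string l ?M by unfold_locales (use b is_string_point_string in \<open>simp_all\<close>)
  have "{s \<in> {0..l}. s \<noteq> b} = {0..l} - {b}" by auto
  then have "emeasure ?M {s \<in> {0..l}. s \<noteq> b} = 0"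
    by (subst emeasure_point_string) auto
  then have "AE s in ?M. s = b"
    using in_sets_M[of "{0..l} - {b}"] \<open>{s \<in> {0..l}. s \<noteq> b} = {0..l} - {b}\<close>
    by (subst AE_iff_measurable[OF _ refl]) (auto simp: space_M)
  then have "(LINT s|?M. f s) = (LINT s|?M. f b)"
    using continuous_on_measurable_M[OF f] by (intro integral_cong_AE) auto
  also have "\<dots> = \<mu> * f b"
    using emeasure_point_string[of "{0..l}" l \<mu> b] b \<mu>
        by (simp add: space_M measure_def scaleR_conv_of_real)
  finally show ?thesis .
qed

lemma string_F_point_string:
  assumes b: "b \<in> {0..l}" "l > 0" and \<mu>: "\<mu> \<ge> 0"
  shows "string_F l (point_string l \<mu> b) z = 1 - z\<^sup>2 * \<mu> * (l - b) - \<i> * z * \<mu>"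
proof -
  let ?M = "point_string l \<mu> b"
  interpret krein_string l ?M by unfold_locales (use b is_string_point_string in \<open>simp_all\<close>)
  \<comment> \<open>A broken line: 1 up to the atom, then slope
    \<open>- z\<^sup>2 * \<mu>\<close>.\<close>
  define \<phi> where "\<phi> x = 1 - z\<^sup>2 * (complex_of_real \<mu> * complex_of_real (max 0 (x - b)))" for x
  have cont: "continuous_on {0..l} \<phi>" unfolding \<phi>_def by (intro continuous_intros)
  have "\<phi> b = 1" by (simp add: \<phi>_def)
  then have "is_string_solution l ?M z \<phi>"
    unfolding string_solution_iff using cont
    by (subst integral_point_string) (use b \<mu> in \<open>auto intro!: continuous_intros simp: \<phi>_def\<close>)
  from string_phi_unique[OF this] have eq: "x \<in> {0..l} \<Longrightarrow> string_phi l ?M z x = \<phi> x" for x .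
  have "(LINT s:{0..l}|?M. string_phi l ?M z s) = (LINT s|?M. \<phi> s)"
    unfolding set_lebesgue_integral_def
        by (rule Bochner_Integration.integral_cong) (auto simp: space_M eq)
  also have "\<dots> = \<mu>" using integral_point_string[OF b \<mu> cont] \<open>\<phi> b = 1\<close> by simp
  finally show ?thesis using b by (simp add: string_F_def eq) (simp add: \<phi>_def)
qed

subsection \<open>Quasi-eigenvalues\<close>

locale krein_eigenfunction = krein_solution +
  assumes boundary: "\<phi> l = k * Nle l"
begin

text \<open>Otherwise \<open>\<phi> l = 1\<close> while \<open>N(l) = 0\<close>, against the
  boundary condition.\<close>

lemma Ale_end_pos: "Ale l > 0"
proof (rule ccontr)
  assume "\<not> Ale l > 0"
  then have A: "Ale l = 0" using Ale_nonneg[of l] by simp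
  have "Nle l = (LINT s|M. 0)" unfolding Nle_end
    using Ale_eq_0[OF A] AE_space by (intro integral_cong_AE) (auto simp: space_M)
  with boundary phi_eq_1[OF A] l_pos show False by simp
qed

lemma balance:
  "k * (norm (Nle l))\<^sup>2 = Ale l + k\<^sup>2 * Q l"
  using energy_le[of l] l_pos boundary complex_norm_square[of "Nle l"] by (simp add: mult.assoc)

lemma balance_Re: "Re k * (norm (Nle l))\<^sup>2 = Ale l + ((Re k)\<^sup>2 - (Im k)\<^sup>2) * Q l"
  using arg_cong[OF balance, of Re] by (simp add: Re_power2)

lemma balance_Im:
  assumes "Im k \<noteq> 0"
  shows "(norm (Nle l))\<^sup>2 = 2 * Re k * Q l"
  using arg_cong[OF balance, of Im] assms by (simp add: Im_power2)

lemma balance_norm: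
  assumes "Im k \<noteq> 0"
  shows "Ale l = ((Re k)\<^sup>2 + (Im k)\<^sup>2) * Q l"
  using balance_Re unfolding balance_Im[OF assms] by (simp add: power2_eq_square algebra_simps)

lemma Q_end_pos: "Im k \<noteq> 0 \<Longrightarrow> Q l > 0"
  using Ale_end_pos Q_nonneg[of l] balance_norm by (cases "Q l = 0") auto

context
  fixes m :: real
  assumes m_pos: "m > 0" and mass_le: "measure M (space M) \<le> m"
begin

lemma Nle_end_le: "(norm (Nle l))\<^sup>2 \<le> m * Ale l"
  using Nle_sq_le[of l] mult_right_mono[OF mass_le Ale_nonneg[of l]] by linarith

text \<open>For real \<open>k\<close> the imaginary part of \<open>balance\<close> is void. Dropping
  the term with \<open>Q\<close> from the real part gives
  \<open>A \<le> \<beta> |N|\<^sup>2 \<le> \<beta> m A\<close> at \<open>l\<close>.\<close>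

lemma real_eigenvalue_ge:
  assumes "Im k = 0"
  shows "Re k \<ge> 1 / m" and "Re k = 1 / m \<Longrightarrow> (norm (Nle l))\<^sup>2 = m * Ale l"
proof -
  have ge: "Re k * (norm (Nle l))\<^sup>2 \<ge> Ale l" using balance_Re assms Q_nonneg[of l] by simp
  then have pos: "Re k * (norm (Nle l))\<^sup>2 > 0" using Ale_end_pos by simp
  then have k: "Re k > 0" by (simp add: zero_less_mult_iff)
  have "1 * Ale l \<le> (Re k * m) * Ale l"
    using ge mult_left_mono[OF Nle_end_le less_imp_le[OF k]] by (simp only: mult_1 mult.assoc)
  then have "1 \<le> Re k * m" using Ale_end_pos by (simp only: mult_le_cancel_right_pos)
  then show "Re k \<ge> 1 / m" using m_pos by (simp add: field_simps)
  show "(norm (Nle l))\<^sup>2 = m * Ale l" if "Re k = 1 / m"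
    using ge Nle_end_le that m_pos by (simp add: field_simps)
qed

text \<open>Cauchy-Schwarz divided by \<open>Q l > 0\<close>. Geometrically, \<open>k\<close> lies
  outside the open disc of radius \<open>1/m\<close> about \<open>1/m\<close>, and equality puts it
  on the circle.\<close>

lemma complex_eigenvalue_norm:
  assumes "Im k \<noteq> 0"
  shows "2 * Re k \<le> m * ((Re k)\<^sup>2 + (Im k)\<^sup>2)"
    and "2 * Re k = m * ((Re k)\<^sup>2 + (Im k)\<^sup>2) \<Longrightarrow> (norm (Nle l))\<^sup>2 = m * Ale l"
proof -
  have "2 * Re k * Q l \<le> (m * ((Re k)\<^sup>2 + (Im k)\<^sup>2)) * Q l"
    using Nle_end_le unfolding balance_Im[OF assms] balance_norm[OF assms] by (simp add: mult.assoc)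
  then show "2 * Re k \<le> m * ((Re k)\<^sup>2 + (Im k)\<^sup>2)" using Q_end_pos[OF assms] by simp
  show "(norm (Nle l))\<^sup>2 = m * Ale l" if "2 * Re k = m * ((Re k)\<^sup>2 + (Im k)\<^sup>2)"
    unfolding balance_Im[OF assms] balance_norm[OF assms] that by simp
qed

lemma complex_eigenvalue_Re_ge:
  assumes im: "Im k \<noteq> 0" and freq: "(Im k)\<^sup>2 * (m * l) \<le> 1"
  shows "Re k \<ge> 1 / (2 * l)" and "Re k = 1 / (2 * l) \<Longrightarrow> AE s in M. s = 0"
proof -
  have "1 * Q l \<le> (l * (2 * Re k)) * Q l"
    using Q_le_end[OF m_pos mass_le freq] unfolding balance_Im[OF im] by (simp add: mult.assoc)
  then have "1 \<le> l * (2 * Re k)" using Q_end_pos[OF im] by (simp only: mult_le_cancel_right_pos)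
  then show "Re k \<ge> 1 / (2 * l)" using l_pos by (simp add: field_simps)
  assume eq: "Re k = 1 / (2 * l)"
  show "AE s in M. s = 0"
    using Q_end_pos[OF im] l_pos
    by (intro Q_eq_end_imp_concentrated[OF m_pos mass_le freq]) (auto simp: balance_Im[OF im] eq)
qed

end

end

lemma admissible_eigenfunction:
  assumes l: "l > 0" and m: "m > 0" and M: "M \<in> admissible_strings l m"
      and z: "z \<in> quasi_eigenvalues l M"
  shows "krein_eigenfunction l M (\<i> * z) (string_phi l M z)" "measure M (space M) \<le> m"
proof -
  interpret krein_string l M using l M by unfold_locales (auto simp: admissible_strings_def)
  have sol: "continuous_on {0..l} (string_phi l M z)"
    "\<And>x. x \<in> {0..l} \<Longrightarrow> string_phi l M z x =
        1 - z\<^sup>2 * (LINT s|M. complex_of_real (max 0 (x - s)) * string_phi l M z s)"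
    using string_phi_solution[of z] unfolding string_solution_iff by blast+
  interpret krein_solution l M "\<i> * z" "string_phi l M z"
    by unfold_locales (use sol in \<open>auto simp: power_mult_distrib\<close>)
  have "(LINT s:{0..l}|M. string_phi l M z s) = Nle l"
    unfolding set_lebesgue_integral_def Nle_end
    by (rule Bochner_Integration.integral_cong) (auto simp: space_M)
  then show "krein_eigenfunction l M (\<i> * z) (string_phi l M z)"
    using z by unfold_locales (simp add: quasi_eigenvalues_def string_F_def)
  have "emeasure M (space M) \<le> ennreal m" using M by (simp add: admissible_strings_def space_M)
  then show "measure M (space M) \<le> m" using m by (simp add: emeasure_eq_measure)
qed


section \<open>Optimal parameters and the minimal decay rate\<close>

definition optimal_mass :: "real \<Rightarrow> real \<Rightarrow> real \<Rightarrow> real" where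
  "optimal_mass l m \<alpha> = (if \<alpha> \<noteq> 0 \<and> \<alpha>\<^sup>2 \<ge> 1 / (m * l) - 1 / (4 * l\<^sup>2)
     then 1 / (1 / (4 * l) + \<alpha>\<^sup>2 * l) else m)"

definition optimal_position :: "real \<Rightarrow> real \<Rightarrow> real \<Rightarrow> real" where
  "optimal_position l m \<alpha> = (if \<alpha> = 0 then l else if \<alpha>\<^sup>2 \<ge> 1 / (m * l) - 1 / (4 * l\<^sup>2) then 0
     else l - 1 / (2 * (1 / m) + 2 * sqrt (1 / m\<^sup>2 - \<alpha>\<^sup>2)))"

context
  fixes l m \<alpha> :: real
  assumes l_pos: "l > 0" and m_pos: "m > 0" and freq: "\<alpha>\<^sup>2 * (m * l) \<le> 1"
begin

text \<open>Real and imaginary parts of the explicit quadratic \<open>F\<close>. For nonzero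
  \<open>\<alpha>\<close> and \<open>\<mu>\<close> the imaginary part ties the position to the decay
  rate by \<open>2 * \<beta> * (l - b) = 1\<close>.\<close>

lemma point_string_quasi_eigenvalue_iff:
  assumes "b \<in> {0..l}" "\<mu> \<ge> 0"
  shows "complex_of_real \<alpha> - \<i> * complex_of_real \<beta> \<in> quasi_eigenvalues l (point_string l \<mu> b) \<longleftrightarrow>
    1 + (\<beta>\<^sup>2 - \<alpha>\<^sup>2) * \<mu> * (l - b) - \<beta> * \<mu> = 0 \<and> \<alpha> * \<mu> * (2 * \<beta> * (l - b) - 1) = 0"
proof -
  have "string_F l (point_string l \<mu> b) (complex_of_real \<alpha> - \<i> * complex_of_real \<beta>) =
    Complex (1 + (\<beta>\<^sup>2 - \<alpha>\<^sup>2) * \<mu> * (l - b) - \<beta> * \<mu>) (\<alpha> * \<mu> * (2 * \<beta> * (l - b) - 1))"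
    unfolding string_F_point_string[OF assms(1) l_pos assms(2)]
    by (simp add: complex_eq_iff power2_eq_square algebra_simps)
  then show ?thesis by (simp add: quasi_eigenvalues_def complex_eq_iff)
qed

lemma point_string_admissible:
  assumes "b \<in> {0..l}" "\<mu> \<le> m"
  shows "point_string l \<mu> b \<in> admissible_strings l m"
  using assms is_string_point_string m_pos
  by (auto simp: admissible_strings_def emeasure_point_string ennreal_leI)

text \<open>The right side says that \<open>1/(2l)\<close> lies strictly between the two roots in
  \<open>\<beta>\<close> of \<open>m * (\<beta>\<^sup>2 + \<alpha>\<^sup>2) = 2 * \<beta>\<close>,
  of which \<open>beta1\<close> is the larger in this regime when
  \<open>\<alpha> \<noteq> 0\<close>.\<close>

lemma discriminant_iff:
  "\<alpha>\<^sup>2 < 1 / (m * l) - 1 / (4 * l\<^sup>2) \<longleftrightarrow> (1 / (2 * l) - 1 / m)\<^sup>2 < 1 / m\<^sup>2 - \<alpha>\<^sup>2"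
proof -
  have "(1 / (2 * l) - 1 / m)\<^sup>2 = 1 / (4 * l\<^sup>2) - 1 / (m * l) + 1 / m\<^sup>2"
    using l_pos m_pos by (simp add: field_simps power2_eq_square)
  then show ?thesis by linarith
qed

abbreviation "mass1 \<equiv> optimal_mass l m \<alpha>"
abbreviation "pos1 \<equiv> optimal_position l m \<alpha>"

lemma beta1_middle:
  assumes "\<alpha> \<noteq> 0" "\<alpha>\<^sup>2 < 1 / (m * l) - 1 / (4 * l\<^sup>2)"
  shows "beta1 l m \<alpha> = 1 / m + sqrt (1 / m\<^sup>2 - \<alpha>\<^sup>2)" "beta1 l m \<alpha> > 1 / (2 * l)"
    "2 * beta1 l m \<alpha> = m * ((beta1 l m \<alpha>)\<^sup>2 + \<alpha>\<^sup>2)"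
    "\<bar>1 / (2 * l) - 1 / m\<bar> < sqrt (1 / m\<^sup>2 - \<alpha>\<^sup>2)"
proof -
  define r where "r = sqrt (1 / m\<^sup>2 - \<alpha>\<^sup>2)"
  have disc: "(1 / (2 * l) - 1 / m)\<^sup>2 < 1 / m\<^sup>2 - \<alpha>\<^sup>2" using assms discriminant_iff by blast
  then have r2: "r\<^sup>2 = 1 / m\<^sup>2 - \<alpha>\<^sup>2"
    using zero_le_power2[of "1 / (2 * l) - 1 / m"] unfolding r_def by (intro real_sqrt_pow2) linarith
  show b: "beta1 l m \<alpha> = 1 / m + sqrt (1 / m\<^sup>2 - \<alpha>\<^sup>2)" using assms by (simp add: beta1_def)
  show lt: "\<bar>1 / (2 * l) - 1 / m\<bar> < sqrt (1 / m\<^sup>2 - \<alpha>\<^sup>2)" using real_sqrt_less_mono[OF disc] by simp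
  show "beta1 l m \<alpha> > 1 / (2 * l)" using lt unfolding b by linarith
  have "m * ((1 / m + r)\<^sup>2 + \<alpha>\<^sup>2) = m * (1 / m\<^sup>2 + 2 * (1 / m) * r + r\<^sup>2 + \<alpha>\<^sup>2)"
    by (simp add: power2_sum power_one_over)
  also have "\<dots> = 2 * (1 / m + r)" unfolding r2 using m_pos by (simp add: field_simps power2_eq_square)
  finally show "2 * beta1 l m \<alpha> = m * ((beta1 l m \<alpha>)\<^sup>2 + \<alpha>\<^sup>2)" unfolding b r_def by simp
qed

lemma optimal_string:
  "point_string l mass1 pos1 \<in> admissible_strings l m"
  "complex_of_real \<alpha> - \<i> * complex_of_real (beta1 l m \<alpha>) \<in> quasi_eigenvalues l (point_string l mass1 pos1)"
proof -
  consider (zero) "\<alpha> = 0" | (large) "\<alpha> \<noteq> 0" "\<alpha>\<^sup>2 \<ge> 1 / (m * l) - 1 / (4 * l\<^sup>2)"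
    | (middle) "\<alpha> \<noteq> 0" "\<alpha>\<^sup>2 < 1 / (m * l) - 1 / (4 * l\<^sup>2)" by linarith
  then have "pos1 \<in> {0..l} \<and> 0 \<le> mass1 \<and> mass1 \<le> m \<and>
     1 + ((beta1 l m \<alpha>)\<^sup>2 - \<alpha>\<^sup>2) * mass1 * (l - pos1) - beta1 l m \<alpha> * mass1 = 0 \<and>
     \<alpha> * mass1 * (2 * beta1 l m \<alpha> * (l - pos1) - 1) = 0"
  proof cases
    case zero
    then show ?thesis using l_pos m_pos by (simp add: optimal_position_def optimal_mass_def beta1_def)
  next
    case large
    define d where "d = 1 / (4 * l) + \<alpha>\<^sup>2 * l"
    have d: "d > 0" using l_pos by (simp add: d_def add_pos_nonneg)
    \<comment> \<open>The regime condition multiplied by \<open>l\<close>; it is exactly what makes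
      the mass \<open>1 / d\<close> admissible.\<close>
    have "1 / m \<le> d" using mult_right_mono[OF large(2), of l] l_pos m_pos
      by (simp add: d_def left_diff_distrib power2_eq_square)
    then have "1 / d \<le> m" using d m_pos by (simp add: field_simps)
    moreover have "1 + ((1 / (2 * l))\<^sup>2 - \<alpha>\<^sup>2) * (1 / d) * l - 1 / (2 * l) * (1 / d) = 0"
    proof -
      have "((1 / (2 * l))\<^sup>2 - \<alpha>\<^sup>2) * l - 1 / (2 * l) = - d"
        using l_pos by (simp add: d_def field_simps power2_eq_square)
      moreover have "1 + ((1 / (2 * l))\<^sup>2 - \<alpha>\<^sup>2) * (1 / d) * l - 1 / (2 * l) * (1 / d) =
         1 + (((1 / (2 * l))\<^sup>2 - \<alpha>\<^sup>2) * l - 1 / (2 * l)) * (1 / d)" by (simp add: algebra_simps)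
      ultimately show ?thesis using d by simp
    qed
    moreover have "mass1 = 1 / d" "pos1 = 0" "beta1 l m \<alpha> = 1 / (2 * l)"
      using large by (auto simp: optimal_mass_def optimal_position_def beta1_def d_def)
    ultimately show ?thesis using l_pos d by simp
  next
    case middle
    note b = beta1_middle[OF middle]
    let ?b = "beta1 l m \<alpha>"
    have bpos: "?b > 0" using b(2) l_pos by (smt (verit) divide_pos_pos)
    have p: "mass1 = m" "pos1 = l - 1 / (2 * ?b)"
        using middle b(1) by (auto simp: optimal_mass_def optimal_position_def)
    \<comment> \<open>The bound \<open>beta1 > 1/(2l)\<close> keeps the atom inside
      \<open>[0, l]\<close>.\<close>
    have "1 / (2 * ?b) \<le> l" using b(2) bpos l_pos by (simp add: field_simps)
    moreover have "1 + (?b\<^sup>2 - \<alpha>\<^sup>2) * m * (1 / (2 * ?b)) - ?b * m = 0"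
    proof -
      have "1 + (?b\<^sup>2 - \<alpha>\<^sup>2) * m * (1 / (2 * ?b)) - ?b * m =
          (2 * ?b - m * (?b\<^sup>2 + \<alpha>\<^sup>2)) * (1 / (2 * ?b))"
        using bpos by (simp add: field_simps power2_eq_square)
      then show ?thesis using b(3) by simp
    qed
    ultimately show ?thesis unfolding p using bpos m_pos l_pos by (simp add: less_imp_le)
  qed
  then show "point_string l mass1 pos1 \<in> admissible_strings l m"
    "complex_of_real \<alpha> - \<i> * complex_of_real (beta1 l m \<alpha>) \<in> quasi_eigenvalues l (point_string l mass1 pos1)"
    using point_string_admissible point_string_quasi_eigenvalue_iff by blast+
qed

text \<open>Each regime has its own sharp inequality: the real-\<open>k\<close> bound for
  \<open>\<alpha> = 0\<close>, the virial bound for large \<open>|\<alpha>|\<close>, and in between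
  the disc bound aided by the virial bound. Equality concentrates \<open>M\<close> at one point, and
  the explicit \<open>F\<close> then fixes the remaining parameter.\<close>

lemma decay_lower_bound:
  assumes M: "M \<in> admissible_strings l m"
    and z: "complex_of_real \<alpha> - \<i> * complex_of_real \<beta> \<in> quasi_eigenvalues l M"
  shows "beta1 l m \<alpha> \<le> \<beta>" and "\<beta> = beta1 l m \<alpha> \<Longrightarrow> M = point_string l mass1 pos1"
proof -
  let ?z = "complex_of_real \<alpha> - \<i> * complex_of_real \<beta>"
  let ?\<mu> = "measure M (space M)"
  note adm = admissible_eigenfunction[OF l_pos m_pos M z]
  interpret krein_eigenfunction l M "\<i> * ?z" "string_phi l M ?z" by (rule adm(1))
  have k: "Re (\<i> * ?z) = \<beta>" "Im (\<i> * ?z) = \<alpha>" by simp_all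
  \<comment> \<open>Each pair consists of a bound and its equality case: 1 and 2 for real
    \<open>k\<close>, 3 and 4 from Cauchy-Schwarz, 5 and 6 from the virial identity.\<close>
  note bounds = real_eigenvalue_ge[OF m_pos adm(2), unfolded k]
    complex_eigenvalue_norm[OF m_pos adm(2), unfolded k]
    complex_eigenvalue_Re_ge[OF m_pos adm(2), unfolded k, OF _ freq]
  have point: "M = point_string l \<mu> b \<and> 1 + (\<beta>\<^sup>2 - \<alpha>\<^sup>2) * \<mu> * (l - b) - \<beta> * \<mu> = 0 \<and>
      \<alpha> * \<mu> * (2 * \<beta> * (l - b) - 1) = 0" if "AE s in M. s = b" "b \<in> {0..l}" "?\<mu> = \<mu>" for b \<mu>
  proof -
    have M_eq: "M = point_string l \<mu> b"
      using concentrated_imp_point_string[OF that(1,2)] unfolding that(3) .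
    have "\<mu> \<ge> 0" using that(3) by (auto simp: measure_nonneg)
    with z[unfolded M_eq] M_eq show ?thesis
      using point_string_quasi_eigenvalue_iff[OF that(2), of \<mu> \<beta>] by blast
  qed
  have full: "?\<mu> = m \<and> (\<exists>b\<in>{0..l}. AE s in M. s = b)"
    if "(norm (Nle l))\<^sup>2 = m * Ale l" "\<beta> > 0"
    using adm(2) that(1) Ale_end_pos m_pos
  proof (rule Cauchy_Schwarz_eq_imp_concentrated)
    show "\<i> * ?z \<noteq> 0" using that(2) k(1) by (metis order_less_irrefl zero_complex.simps(1))
  qed
  consider (zero) "\<alpha> = 0" | (large) "\<alpha> \<noteq> 0" "\<alpha>\<^sup>2 \<ge> 1 / (m * l) - 1 / (4 * l\<^sup>2)"
    | (middle) "\<alpha> \<noteq> 0" "\<alpha>\<^sup>2 < 1 / (m * l) - 1 / (4 * l\<^sup>2)" by linarith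
  then have "beta1 l m \<alpha> \<le> \<beta> \<and> (\<beta> = beta1 l m \<alpha> \<longrightarrow> M = point_string l mass1 pos1)"
  proof cases
    case zero
    have "M = point_string l mass1 pos1" if \<beta>: "\<beta> = 1 / m"
    proof -
      have "\<beta> > 0" using \<beta> m_pos by simp
      then obtain b where b: "b \<in> {0..l}" "AE s in M. s = b" and \<mu>: "?\<mu> = m"
        using full bounds(2)[OF zero \<beta>] by blast
      have "\<beta>\<^sup>2 * m * (l - b) = 0" using point[OF b(2,1) \<mu>] \<beta> zero m_pos by simp
      then have "b = l" using \<open>\<beta> > 0\<close> m_pos by simp
      with point[OF b(2,1) \<mu>] zero show ?thesis by (simp add: optimal_mass_def optimal_position_def)
    qed
    then show ?thesis using bounds(1)[OF zero] zero by (simp add: beta1_def)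
  next
    case large
    have b1: "beta1 l m \<alpha> = 1 / (2 * l)" using large by (simp add: beta1_def)
    have "M = point_string l mass1 pos1" if \<beta>: "\<beta> = 1 / (2 * l)"
    proof -
      obtain \<mu> where \<mu>: "?\<mu> = \<mu>" by blast
      have "0 \<in> {0..l}" using l_pos by simp
      from point[OF bounds(6)[OF large(1) \<beta>] this \<mu>]
      have P: "M = point_string l \<mu> 0" and "1 + (\<beta>\<^sup>2 - \<alpha>\<^sup>2) * \<mu> * (l - 0) - \<beta> * \<mu> = 0" by blast+
      then have "\<mu> * (\<beta> - \<beta>\<^sup>2 * l + \<alpha>\<^sup>2 * l) = 1" by (simp add: algebra_simps)
      moreover have "\<beta> - \<beta>\<^sup>2 * l + \<alpha>\<^sup>2 * l = 1 / (4 * l) + \<alpha>\<^sup>2 * l"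
        unfolding \<beta> using l_pos by (simp add: field_simps power2_eq_square)
      moreover have "1 / (4 * l) + \<alpha>\<^sup>2 * l > 0" using l_pos by (simp add: add_pos_nonneg)
      ultimately have "\<mu> = mass1" using large by (simp add: optimal_mass_def eq_divide_eq)
      moreover have "pos1 = 0" using large by (simp add: optimal_position_def)
      ultimately show ?thesis using P by simp
    qed
    then show ?thesis using bounds(5)[OF large(1)] b1 by simp
  next
    case middle
    note b1 = beta1_middle[OF middle]
    let ?b = "beta1 l m \<alpha>"
    define r where "r = sqrt (1 / m\<^sup>2 - \<alpha>\<^sup>2)"
    have "?b = 1 / m + r" "\<bar>1 / (2 * l) - 1 / m\<bar> < r" using b1 unfolding r_def by blast+
    then have "r \<ge> 0" by linarith
    have factor: "m * (\<beta> - (1 / m - r)) * (\<beta> - ?b) = m * (\<beta>\<^sup>2 + \<alpha>\<^sup>2) - 2 * \<beta>"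
    proof -
      have "m * (\<beta> - (1 / m - r)) * (\<beta> - ?b) = m * \<beta>\<^sup>2 - 2 * \<beta> + (2 * ?b - m * ?b\<^sup>2)"
        unfolding \<open>?b = 1 / m + r\<close> using m_pos by (simp add: field_simps power2_eq_square)
      then show ?thesis using b1(3) unfolding distrib_left by linarith
    qed
    \<comment> \<open>Cauchy-Schwarz alone allows \<open>\<beta>\<close> at or below the smaller
      root \<open>1 / m - r\<close>. The virial bound excludes this, since \<open>1/(2l)\<close>
      exceeds that root.\<close>
    have pos: "\<beta> - (1 / m - r) > 0" using bounds(5)[OF middle(1)] \<open>\<bar>1 / (2 * l) - 1 / m\<bar> < r\<close> by linarith
    have "0 \<le> (m * (\<beta> - (1 / m - r))) * (\<beta> - ?b)" using factor bounds(3)[OF middle(1)] by simp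
    moreover have "m * (\<beta> - (1 / m - r)) > 0" using pos m_pos by (rule mult_pos_pos[rotated])
    ultimately have le: "?b \<le> \<beta>" by (simp add: zero_le_mult_iff)
    have "M = point_string l mass1 pos1" if \<beta>: "\<beta> = ?b"
    proof -
      have "\<beta> > 0" using \<beta> \<open>?b = 1 / m + r\<close> \<open>r \<ge> 0\<close> m_pos by (simp add: add_pos_nonneg)
      moreover have "2 * \<beta> = m * (\<beta>\<^sup>2 + \<alpha>\<^sup>2)" unfolding \<beta> by (rule b1(3))
      ultimately obtain b where b: "b \<in> {0..l}" "AE s in M. s = b" and \<mu>: "?\<mu> = m"
        using full bounds(4)[OF middle(1)] by blast
      have "2 * \<beta> * (l - b) = 1" using point[OF b(2,1) \<mu>] middle(1) m_pos by simp
      then have "b = l - 1 / (2 * \<beta>)" using \<open>\<beta> > 0\<close> by (simp add: field_simps)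
      also have "\<dots> = pos1" using middle \<beta> b1(1) by (simp add: optimal_position_def)
      finally show ?thesis using point[OF b(2,1) \<mu>] middle by (simp add: optimal_mass_def)
    qed
    with le show ?thesis by blast
  qed
  then show "beta1 l m \<alpha> \<le> \<beta>" and "\<beta> = beta1 l m \<alpha> \<Longrightarrow> M = point_string l mass1 pos1" by auto
qed

lemma beta_min_eq_beta1: "beta_min l m \<alpha> = ereal (beta1 l m \<alpha>)"
proof (rule antisym)
  show "beta_min l m \<alpha> \<le> ereal (beta1 l m \<alpha>)" unfolding beta_min_def
    by (rule INF_lower) (use optimal_string in \<open>auto simp: admissible_quasi_eigenvalues_def\<close>)
  show "ereal (beta1 l m \<alpha>) \<le> beta_min l m \<alpha>" unfolding beta_min_def
    by (rule INF_greatest) (auto simp: admissible_quasi_eigenvalues_def intro: decay_lower_bound(1))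
qed

lemma minimal_decay_iff: "minimal_decay l m \<alpha> M \<longleftrightarrow> M = point_string l mass1 pos1"
  unfolding minimal_decay_def beta_min_eq_beta1 ereal.inject
  using optimal_string decay_lower_bound(2)[OF _ _ refl] by blast

end

theorem theorem7p2:
  fixes l m \<alpha> :: real
  assumes "l > 0" and "m > 0"
    and "- (1 / sqrt (m * l)) \<le> \<alpha>" and "\<alpha> \<le> 1 / sqrt (m * l)"
  shows "beta_min l m \<alpha> = ereal (beta1 l m \<alpha>) \<and>
    (\<exists>!M. minimal_decay l m \<alpha> M) \<and>
    (\<alpha> = 0 \<longrightarrow> minimal_decay_string l m \<alpha> = point_string l m l) \<and>
    (0 < \<alpha>\<^sup>2 \<and> \<alpha>\<^sup>2 < 1 / (m * l) - 1 / (4 * l\<^sup>2) \<longrightarrow>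
       minimal_decay_string l m \<alpha> =
         point_string l m (l - 1 / (2 * (1 / m) + 2 * sqrt (1 / m\<^sup>2 - \<alpha>\<^sup>2)))) \<and>
    (\<alpha> \<noteq> 0 \<and> \<alpha>\<^sup>2 \<ge> 1 / (m * l) - 1 / (4 * l\<^sup>2) \<longrightarrow>
       minimal_decay_string l m \<alpha> =
         point_string l (1 / (1 / (4 * l) + \<alpha>\<^sup>2 * l)) 0)"
proof -
  have "\<bar>\<alpha>\<bar> \<le> 1 / sqrt (m * l)" using assms(3,4) by linarith
  then have "\<alpha>\<^sup>2 \<le> (1 / sqrt (m * l))\<^sup>2" by (metis abs_ge_zero power2_abs power_mono)
  also have "\<dots> = 1 / (m * l)" using assms(1,2) by (simp add: power_divide)
  finally have freq: "\<alpha>\<^sup>2 * (m * l) \<le> 1" using assms(1,2) by (simp add: pos_le_divide_eq)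
  note iff = minimal_decay_iff[OF assms(1,2) freq]
  have "minimal_decay_string l m \<alpha> = point_string l (optimal_mass l m \<alpha>) (optimal_position l m \<alpha>)"
    unfolding minimal_decay_string_def by (rule the_equality) (auto simp: iff)
  then show ?thesis
    using beta_min_eq_beta1[OF assms(1,2) freq] by (auto simp: iff optimal_mass_def optimal_position_def)
qed

end
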